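(* Let $a:[0,1]\to\mathbb{R}$ have bounded variation on $[0,1]$. Let $e_1,e_2,\ldots$ be random variables with $Ee_i=0$ for all $i$ such that, for some $\sigma>0$, as $N\to\infty$, $$N^{-1/2}\sum_{\ell=1}^{\lfloor Nt\rfloor}e_\ell \;\stackrel{\mathcal{D}[0,1]}{\longrightarrow}\;\sigma W(t),$$ where $W$ is a Wiener process. For $1\le i\le N$ put $u_i=u_{i,N}=a(i/N)e_i$. Then, as $N\to\infty$, $$N^{-1/2}\sum_{\ell=1}^{\lfloor Nt\rfloor}u_\ell\;\stackrel{\mathcal{D}[0,1]}{\longrightarrow}\;W(b(t)),\qquad\text{where}\quad b(t)=\sigma^2\int_0^t a^2(u)\,du,$$ and $W(u)$, $0\le u<\infty$, is a Wiener process (standard Brownian motion).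
   Context: $\stackrel{\mathcal{D}[0,1]}{\longrightarrow}$ denotes weak convergence in the Skorokhod space $\mathcal{D}[0,1]$ of c\`adl\`ag functions on $[0,1]$. $\lfloor x\rfloor$ is the integer part. No stationarity or mixing of $(e_i)$ is assumed. *)

theory Defs
  imports "HOL-Probability.Probability"
begin

section \<open>The Skorokhod space \<open>\<D>[0,1]\<close>\<close>

definition cadlag_on_01 :: "(real \<Rightarrow> real) \<Rightarrow> bool" where
  "cadlag_on_01 f \<longleftrightarrow>
     (\<forall>t\<in>{0..<1}. (f \<longlongrightarrow> f t) (at_right t)) \<and>
     (\<forall>t\<in>{0<..1}. \<exists>l. (f \<longlongrightarrow> l) (at_left t))"

lemma cadlag_on_01_cong:
  assumes "\<And>t. t \<in> {0..1} \<Longrightarrow> f t = g t"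
  shows "cadlag_on_01 f \<longleftrightarrow> cadlag_on_01 g"
proof -
  have "(f \<longlongrightarrow> f t) (at_right t) \<longleftrightarrow> (g \<longlongrightarrow> g t) (at_right t)" if "t \<in> {0..<1}" for t
  proof -
    have "\<forall>\<^sub>F x in at_right t. f x = g x"
      using that assms unfolding eventually_at_right[of t 1, simplified] eventually_at_right_field
      by (auto intro!: exI[of _ 1])
    moreover have "f t = g t" using that assms by auto
    ultimately show ?thesis by (simp add: tendsto_cong)
  qed
  moreover have "(f \<longlongrightarrow> l) (at_left t) \<longleftrightarrow> (g \<longlongrightarrow> l) (at_left t)" if "t \<in> {0<..1}" for t l
  proof -
    have "\<forall>\<^sub>F x in at_left t. f x = g x"
      using that assms unfolding eventually_at_left_field
      by (auto intro!: exI[of _ 0])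
    then show ?thesis by (rule tendsto_cong)
  qed
  ultimately show ?thesis unfolding cadlag_on_01_def by auto
qed

text \<open>Functions on \<open>[0,1]\<close> are total functions that are \<^const>\<open>undefined\<close> outside \<open>[0,1]\<close>,
  so that equality in the type is equality on \<open>[0,1]\<close>.\<close>

typedef skorokhod01 = "{f \<in> extensional {0..1::real}. cadlag_on_01 f}"
  morphisms apply_skorokhod01 Skorokhod01
proof -
  have "cadlag_on_01 (\<lambda>_. 0)" by (auto simp: cadlag_on_01_def)
  then have "cadlag_on_01 (restrict (\<lambda>_. 0) {0..1})"
    by (subst cadlag_on_01_cong[where g = "\<lambda>_. 0"]) auto
  then show ?thesis by (intro exI[of _ "restrict (\<lambda>_. 0) {0..1}"]) auto
qed

definition time_change01 :: "(real \<Rightarrow> real) \<Rightarrow> bool" where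
  "time_change01 \<mu> \<longleftrightarrow>
     strict_mono_on {0..1} \<mu> \<and> continuous_on {0..1} \<mu> \<and> \<mu> ` {0..1} = {0..1}"

definition skorokhod_close :: "real \<Rightarrow> (real \<Rightarrow> real) \<Rightarrow> (real \<Rightarrow> real) \<Rightarrow> bool" where
  "skorokhod_close \<epsilon> f g \<longleftrightarrow>
     (\<exists>\<mu>. time_change01 \<mu> \<and> (\<forall>t\<in>{0..1}. \<bar>\<mu> t - t\<bar> \<le> \<epsilon> \<and> \<bar>f t - g (\<mu> t)\<bar> \<le> \<epsilon>))"

lemma time_change01_id: "time_change01 (\<lambda>t. t)"
  by (auto simp: time_change01_def strict_mono_on_def)

lemma time_change01_mem: "time_change01 l \<Longrightarrow> t \<in> {0..1} \<Longrightarrow> l t \<in> {0..1}"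
  unfolding time_change01_def by (metis imageI)

lemma time_change01_comp:
  assumes "time_change01 l" "time_change01 m"
  shows "time_change01 (\<lambda>t. m (l t))"
  unfolding time_change01_def
proof (intro conjI)
  show "strict_mono_on {0..1} (\<lambda>t. m (l t))"
  proof (rule strict_mono_onI)
    fix r s :: real assume "r \<in> {0..1}" "s \<in> {0..1}" "r < s"
    moreover from this have "l r < l s"
      using assms(1) unfolding time_change01_def by (auto intro: strict_mono_onD)
    ultimately show "m (l r) < m (l s)"
      using assms time_change01_mem[OF assms(1)] unfolding time_change01_def
      by (metis strict_mono_onD)
  qed
  show "continuous_on {0..1} (\<lambda>t. m (l t))"
    using assms unfolding time_change01_def
    by (intro continuous_on_compose2[of "{0..1}" m "{0..1}" l]) auto
  have "(\<lambda>t. m (l t)) ` {0..1} = m ` (l ` {0..1})" by auto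
  then show "(\<lambda>t. m (l t)) ` {0..1} = {0..1}"
    using assms unfolding time_change01_def by simp
qed

lemma time_change01_inverse:
  assumes "time_change01 l"
  obtains m where "time_change01 m" "\<And>t. t \<in> {0..1} \<Longrightarrow> m (l t) = t" "\<And>t. t \<in> {0..1} \<Longrightarrow> l (m t) = t"
proof -
  define m where "m = inv_into {0..1} l"
  have inj: "inj_on l {0..1}" and im: "l ` {0..1} = {0..1}" and sm: "strict_mono_on {0..1} l"
    using assms by (simp_all add: time_change01_def strict_mono_on_imp_inj_on)
  have ml: "m (l t) = t" if "t \<in> {0..1}" for t
    unfolding m_def using inv_into_f_f[OF inj that] .
  have lm: "l (m t) = t" if "t \<in> {0..1}" for t
    unfolding m_def by (rule f_inv_into_f) (use that im in auto)
  have mim: "m ` {0..1} = {0..1}"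
    unfolding m_def using inv_into_image_cancel[OF inj subset_refl] im by simp
  have "continuous_on (l ` {0..1}) m"
    by (rule continuous_on_inv) (use assms ml in \<open>simp_all add: time_change01_def\<close>)
  moreover have "strict_mono_on {0..1} m"
  proof (rule strict_mono_onI)
    fix r s :: real assume rs: "r \<in> {0..1}" "s \<in> {0..1}" "r < s"
    have mm: "m r \<in> {0..1}" "m s \<in> {0..1}" using mim rs by auto
    show "m r < m s"
    proof (rule ccontr)
      assume "\<not> m r < m s"
      then have "m s < m r \<or> m s = m r" by auto
      then have "l (m s) \<le> l (m r)"
        using strict_mono_onD[OF sm mm(2) mm(1)] by (metis order.refl order.strict_implies_order)
      then show False using lm rs by auto
    qed
  qed
  ultimately have "time_change01 m" using im mim by (simp add: time_change01_def)
  then show thesis using ml lm by (rule that)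
qed

lemma skorokhod_close_sym:
  assumes "skorokhod_close e f g"
  shows "skorokhod_close e g f"
proof -
  obtain l where l: "time_change01 l"
    "\<And>t. t \<in> {0..1} \<Longrightarrow> \<bar>l t - t\<bar> \<le> e \<and> \<bar>f t - g (l t)\<bar> \<le> e"
    using assms unfolding skorokhod_close_def by blast
  obtain m where m: "time_change01 m" "\<And>t. t \<in> {0..1} \<Longrightarrow> l (m t) = t"
    using l(1) by (rule time_change01_inverse) (rule that, assumption+)
  have "\<bar>m t - t\<bar> \<le> e \<and> \<bar>g t - f (m t)\<bar> \<le> e" if "t \<in> {0..1}" for t
  proof -
    have "m t \<in> {0..1}" using m(1) that by (rule time_change01_mem)
    from l(2)[OF this] m(2)[OF that] show ?thesis by (simp add: abs_minus_commute)
  qed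
  then show ?thesis using m(1) unfolding skorokhod_close_def by blast
qed

lemma skorokhod_close_trans:
  assumes "skorokhod_close d f g" "skorokhod_close e g h"
  shows "skorokhod_close (d + e) f h"
proof -
  obtain l where l: "time_change01 l"
    "\<And>t. t \<in> {0..1} \<Longrightarrow> \<bar>l t - t\<bar> \<le> d \<and> \<bar>f t - g (l t)\<bar> \<le> d"
    using assms(1) unfolding skorokhod_close_def by blast
  obtain m where m: "time_change01 m"
    "\<And>t. t \<in> {0..1} \<Longrightarrow> \<bar>m t - t\<bar> \<le> e \<and> \<bar>g t - h (m t)\<bar> \<le> e"
    using assms(2) unfolding skorokhod_close_def by blast
  have "\<bar>m (l t) - t\<bar> \<le> d + e \<and> \<bar>f t - h (m (l t))\<bar> \<le> d + e" if "t \<in> {0..1}" for t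
  proof -
    have "l t \<in> {0..1}" using l(1) that by (rule time_change01_mem)
    from m(2)[OF this] l(2)[OF that] show ?thesis by linarith
  qed
  then show ?thesis using time_change01_comp[OF l(1) m(1)] unfolding skorokhod_close_def by blast
qed

lemma skorokhod_close_nonneg: "skorokhod_close e f g \<Longrightarrow> 0 \<le> e"
  unfolding skorokhod_close_def by (auto dest!: bspec[where x = 0])

lemma cadlag_on_01_bounded:
  assumes "cadlag_on_01 f"
  shows "\<exists>B. \<forall>t\<in>{0..1}. \<bar>f t\<bar> \<le> B"
proof -
  have "(0::real) \<le> 1" by simp
  then have "\<exists>B. \<forall>t\<in>{0..1} \<inter> {0..1}. \<bar>f t\<bar> \<le> B"
  proof (induction rule: Bolzano[where P = "\<lambda>c d. \<exists>B. \<forall>t\<in>{c..d} \<inter> {0..1}. \<bar>f t\<bar> \<le> B"])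
    case (trans a b c)
    then obtain B C where "\<forall>t\<in>{a..b} \<inter> {0..1}. \<bar>f t\<bar> \<le> B" "\<forall>t\<in>{b..c} \<inter> {0..1}. \<bar>f t\<bar> \<le> C" by blast
    then show ?case by (intro exI[of _ "max B C"]) (auto simp: le_max_iff_disj; metis le_cases)
  next
    case (local x)
    have R: "\<exists>d>0. \<exists>B. \<forall>t\<in>{x<..<x+d} \<inter> {0..1}. \<bar>f t\<bar> \<le> B"
    proof (cases "x < 1")
      case True
      then have "(f \<longlongrightarrow> f x) (at_right x)" using assms local by (auto simp: cadlag_on_01_def)
      then have "\<forall>\<^sub>F t in at_right x. dist (f t) (f x) < 1" by (rule tendstoD) simp
      then obtain b where b: "b > x" "\<And>t. x < t \<Longrightarrow> t < b \<Longrightarrow> dist (f t) (f x) < 1"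
        unfolding eventually_at_right_field by blast
      have "\<bar>f t\<bar> \<le> \<bar>f x\<bar> + 1" if "x < t" "t < b" for t
        using b(2)[OF that] by (simp add: dist_real_def)
      then show ?thesis using b(1) by (intro exI[of _ "b - x"] conjI exI[of _ "\<bar>f x\<bar> + 1"]) auto
    next
      case False
      then show ?thesis using local by (intro exI[of _ 1]) auto
    qed
    have L: "\<exists>d>0. \<exists>B. \<forall>t\<in>{x-d<..<x} \<inter> {0..1}. \<bar>f t\<bar> \<le> B"
    proof (cases "x > 0")
      case True
      then have "x \<in> {0<..1}" using local by auto
      then obtain l where "(f \<longlongrightarrow> l) (at_left x)" using assms
        unfolding cadlag_on_01_def by blast
      then have "\<forall>\<^sub>F t in at_left x. dist (f t) l < 1" by (rule tendstoD) simp
      then obtain b where b: "b < x" "\<And>t. b < t \<Longrightarrow> t < x \<Longrightarrow> dist (f t) l < 1"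
        unfolding eventually_at_left_field by blast
      have "\<bar>f t\<bar> \<le> \<bar>l\<bar> + 1" if "b < t" "t < x" for t
        using b(2)[OF that] by (simp add: dist_real_def)
      then show ?thesis using b(1) by (intro exI[of _ "x - b"] conjI exI[of _ "\<bar>l\<bar> + 1"]) auto
    next
      case False
      then show ?thesis using local by (intro exI[of _ 1]) auto
    qed
    obtain d1 B1 where 1: "d1 > 0" "\<And>t. x < t \<Longrightarrow> t < x + d1 \<Longrightarrow> t \<in> {0..1} \<Longrightarrow> \<bar>f t\<bar> \<le> B1"
    proof -
      from R obtain d B where "d > 0" "\<forall>t\<in>{x<..<x+d} \<inter> {0..1}. \<bar>f t\<bar> \<le> B" by blast
      then show thesis using that[of d B] by simp
    qed
    obtain d2 B2 where 2: "d2 > 0" "\<And>t. x - d2 < t \<Longrightarrow> t < x \<Longrightarrow> t \<in> {0..1} \<Longrightarrow> \<bar>f t\<bar> \<le> B2"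
    proof -
      from L obtain d B where "d > 0" "\<forall>t\<in>{x-d<..<x} \<inter> {0..1}. \<bar>f t\<bar> \<le> B" by blast
      then show thesis using that[of d B] by simp
    qed
    have "\<bar>f t\<bar> \<le> max \<bar>f x\<bar> (max B1 B2)" if "a \<le> x" "x \<le> b" "b - a < min d1 d2" "t \<in> {a..b} \<inter> {0..1}" for a b t
      using 1(2)[of t] 2(2)[of t] that by (cases t x rule: linorder_cases) (auto simp: le_max_iff_disj)
    then show ?case using 1(1) 2(1)
      by (intro exI[of _ "min d1 d2"]) (auto intro!: exI[of _ "max \<bar>f x\<bar> (max B1 B2)"])
  qed
  then show ?thesis by simp
qed

lemma ex_skorokhod_close:
  assumes "cadlag_on_01 f" "cadlag_on_01 g"
  shows "\<exists>e. skorokhod_close e f g"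
proof -
  obtain B C where "\<And>t. t \<in> {0..1} \<Longrightarrow> \<bar>f t\<bar> \<le> B" "\<And>t. t \<in> {0..1} \<Longrightarrow> \<bar>g t\<bar> \<le> C"
    using assms[THEN cadlag_on_01_bounded] by blast
  then have BC: "\<bar>f t - g t\<bar> \<le> B + C" if "t \<in> {0..1}" for t
    using that by (smt (verit))
  then have "0 \<le> B + C" by (smt (verit) atLeastAtMost_iff)
  then show ?thesis unfolding skorokhod_close_def using time_change01_id BC
    by (intro exI[of _ "B + C"] exI[of _ "\<lambda>t. t"]) auto
qed

lemma skorokhod_close_0:
  assumes cad: "cadlag_on_01 f" "cadlag_on_01 g"
    and close: "\<And>e. e > 0 \<Longrightarrow> skorokhod_close e f g" and t: "t \<in> {0..1}"
  shows "f t = g t"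
proof (cases "t = 1")
  case True
  have "\<bar>f 1 - g 1\<bar> \<le> e" if e: "e > 0" for e
  proof -
    obtain l where l: "time_change01 l" "\<And>t. t \<in> {0..1} \<Longrightarrow> \<bar>f t - g (l t)\<bar> \<le> e"
      using close[OF e] unfolding skorokhod_close_def by blast
    obtain s where s: "s \<in> {0..1}" "l s = 1"
      using l(1) unfolding time_change01_def by (metis atLeastAtMost_iff imageE order.refl zero_le_one)
    have "l 1 \<le> 1" using l(1) unfolding time_change01_def by (metis atLeastAtMost_iff imageI order.refl zero_le_one)
    have "s = 1"
    proof (rule ccontr)
      assume "s \<noteq> 1"
      then have "l s < l 1" using l(1) s(1) unfolding time_change01_def strict_mono_on_def by auto
      then show False using s \<open>l 1 \<le> 1\<close> by simp
    qed
    then show ?thesis using l(2)[of 1] s by simp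
  qed
  then have "\<bar>f 1 - g 1\<bar> \<le> 0" by (metis field_le_epsilon add_0)
  then show ?thesis using True by simp
next
  case False
  then have t01: "t \<in> {0..<1}" using t by auto
  have "\<bar>f t - g t\<bar> \<le> e" if e: "e > 0" for e
  proof -
    have "\<forall>\<^sub>F s in at_right t. dist (g s) (g t) < e / 3" "\<forall>\<^sub>F s in at_right t. dist (f s) (f t) < e / 3"
      using cad t01 e unfolding cadlag_on_01_def by (blast intro: tendstoD divide_pos_pos zero_less_numeral)+
    then obtain b c where b: "b > t" "\<And>s. t < s \<Longrightarrow> s < b \<Longrightarrow> dist (g s) (g t) < e / 3"
      and c: "c > t" "\<And>s. t < s \<Longrightarrow> s < c \<Longrightarrow> dist (f s) (f t) < e / 3"
      unfolding eventually_at_right_field by blast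
    define d where "d = min (min b c) 1 - t"
    have d: "d > 0" using b(1) c(1) t01 by (auto simp: d_def)
    define s where "s = t + d / 2"
    have "t + d \<le> b" "t + d \<le> c" "t + d \<le> 1" by (simp_all add: d_def)
    moreover have "s < t + d" "t < s" using d by (simp_all add: s_def)
    ultimately have s: "t < s" "s < b" "s < c" "s \<in> {0..1}" using t01 by auto
    obtain l where l: "\<bar>l s - s\<bar> \<le> min (d / 4) (e / 3)" "\<bar>f s - g (l s)\<bar> \<le> min (d / 4) (e / 3)"
    proof -
      have "skorokhod_close (min (d / 4) (e / 3)) f g" using d e by (intro close) simp
      then show thesis using that s(4) unfolding skorokhod_close_def by blast
    qed
    have "t + d \<le> b" by (simp add: d_def)
    moreover have "\<bar>l s - s\<bar> \<le> d / 4" using l(1) by simp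
    ultimately have "t < l s" "l s < b" using d unfolding s_def by linarith+
    from b(2)[OF this] c(2)[OF s(1,3)]
    have "\<bar>g (l s) - g t\<bar> < e / 3" "\<bar>f s - f t\<bar> < e / 3" by (simp_all only: dist_real_def)
    moreover have "\<bar>f s - g (l s)\<bar> \<le> e / 3" using l(2) by simp
    ultimately show ?thesis by linarith
  qed
  then have "\<bar>f t - g t\<bar> \<le> 0" by (metis field_le_epsilon add_0)
  then show ?thesis by simp
qed

text \<open>The metric \<open>d(f,g) = inf\<^bsub>\<mu>\<^esub> max (\<parallel>\<mu> - id\<parallel>\<^bsub>\<infinity>\<^esub>) (\<parallel>f - g \<circ> \<mu>\<parallel>\<^bsub>\<infinity>\<^esub>)\<close> generating Skorokhod's
  \<open>J\<^sub>1\<close> topology; it is not complete, but weak convergence depends on the topology only.\<close>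

instantiation skorokhod01 :: metric_space
begin

definition dist_skorokhod01 :: "skorokhod01 \<Rightarrow> skorokhod01 \<Rightarrow> real" where
  "dist_skorokhod01 x y = Inf {\<epsilon>. skorokhod_close \<epsilon> (apply_skorokhod01 x) (apply_skorokhod01 y)}"

definition uniformity_skorokhod01 :: "(skorokhod01 \<times> skorokhod01) filter" where
  "uniformity_skorokhod01 = (INF e\<in>{0 <..}. principal {(x, y). dist x y < e})"

definition open_skorokhod01 :: "skorokhod01 set \<Rightarrow> bool" where
  "open_skorokhod01 S = (\<forall>x\<in>S. \<forall>\<^sub>F (x', y) in uniformity. x' = x \<longrightarrow> y \<in> S)"

instance
proof
  fix x y z :: skorokhod01
  let ?S = "\<lambda>x y. {e. skorokhod_close e (apply_skorokhod01 x) (apply_skorokhod01 y)}"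
  have cad: "cadlag_on_01 (apply_skorokhod01 x)" "apply_skorokhod01 x \<in> extensional {0..1}" for x
    using apply_skorokhod01[of x] by auto
  have ne: "?S x y \<noteq> {}" for x y using ex_skorokhod_close[OF cad(1) cad(1)] by auto
  have bdd: "bdd_below (?S x y)" for x y by (rule bdd_belowI[of _ 0]) (auto dest: skorokhod_close_nonneg)
  have nonneg: "0 \<le> dist x y" for x y :: skorokhod01
    unfolding dist_skorokhod01_def by (rule cInf_greatest[OF ne]) (auto dest: skorokhod_close_nonneg)
  have approx: "\<exists>e'<e. skorokhod_close e' (apply_skorokhod01 x) (apply_skorokhod01 y)" if "dist x y < e" for x y e
    using cInf_lessD[OF ne[of x y]] that unfolding dist_skorokhod01_def by blast
  have sym: "dist x y = dist y x" for x y :: skorokhod01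
    unfolding dist_skorokhod01_def by (metis skorokhod_close_sym)
  have upper: "dist x y \<le> e" if "skorokhod_close e (apply_skorokhod01 x) (apply_skorokhod01 y)" for x y e
    unfolding dist_skorokhod01_def by (rule cInf_lower) (use that bdd in auto)
  show "dist x y = 0 \<longleftrightarrow> x = y"
  proof
    assume "x = y"
    have "skorokhod_close 0 (apply_skorokhod01 x) (apply_skorokhod01 x)"
      unfolding skorokhod_close_def using time_change01_id by (intro exI[of _ "\<lambda>t. t"]) auto
    then show "dist x y = 0" using upper nonneg \<open>x = y\<close> by (simp add: order_antisym)
  next
    assume d: "dist x y = 0"
    have "skorokhod_close e (apply_skorokhod01 x) (apply_skorokhod01 y)" if e: "e > 0" for e
    proof -
      obtain e' where "e' < e" "skorokhod_close e' (apply_skorokhod01 x) (apply_skorokhod01 y)"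
        using approx[of x y e] d e by auto
      then show ?thesis unfolding skorokhod_close_def by (meson order.strict_implies_order order.trans)
    qed
    then have "apply_skorokhod01 x t = apply_skorokhod01 y t" if "t \<in> {0..1}" for t
      using skorokhod_close_0[OF cad(1) cad(1)] that by blast
    then have "apply_skorokhod01 x = apply_skorokhod01 y" by (intro extensionalityI[OF cad(2) cad(2)])
    then show "x = y" by (simp add: apply_skorokhod01_inject)
  qed
  show "dist x y \<le> dist x z + dist y z"
  proof (rule field_le_epsilon)
    fix e :: real assume "e > 0"
    then obtain d1 d2 where d: "d1 < dist x z + e / 2" "d2 < dist z y + e / 2"
      "skorokhod_close d1 (apply_skorokhod01 x) (apply_skorokhod01 z)"
      "skorokhod_close d2 (apply_skorokhod01 z) (apply_skorokhod01 y)"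
      using approx[of x z "dist x z + e / 2"] approx[of z y "dist z y + e / 2"] by auto
    show "dist x y \<le> dist x z + dist y z + e"
      using upper[OF skorokhod_close_trans[OF d(3,4)]] d(1,2) sym[of y z] by simp
  qed
qed (simp_all add: uniformity_skorokhod01_def open_skorokhod01_def)

end

section \<open>Weak convergence in \<open>\<D>[0,1]\<close>\<close>

text \<open>A process is a family \<open>X t \<omega>\<close>; only the times \<open>t \<in> [0,1]\<close> matter.\<close>

definition path01 :: "(real \<Rightarrow> 'a \<Rightarrow> real) \<Rightarrow> 'a \<Rightarrow> skorokhod01" where
  "path01 X \<omega> = Skorokhod01 (restrict (\<lambda>t. X t \<omega>) {0..1})"

definition random_element_D01 :: "'a measure \<Rightarrow> (real \<Rightarrow> 'a \<Rightarrow> real) \<Rightarrow> bool" where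
  "random_element_D01 M X \<longleftrightarrow>
     prob_space M \<and> (\<forall>\<omega>\<in>space M. cadlag_on_01 (\<lambda>t. X t \<omega>)) \<and> path01 X \<in> M \<rightarrow>\<^sub>M borel"

definition weakly_converges_D01 ::
    "'a measure \<Rightarrow> (nat \<Rightarrow> real \<Rightarrow> 'a \<Rightarrow> real) \<Rightarrow> 'b measure \<Rightarrow> (real \<Rightarrow> 'b \<Rightarrow> real) \<Rightarrow> bool" where
  "weakly_converges_D01 M X M' Y \<longleftrightarrow>
     (\<forall>N. random_element_D01 M (X N)) \<and> random_element_D01 M' Y \<and>
     (\<forall>F :: skorokhod01 \<Rightarrow> real. continuous_on UNIV F \<and> bounded (range F) \<longrightarrow>
        (\<lambda>N. \<integral>\<omega>. F (path01 (X N) \<omega>) \<partial>M) \<longlonglongrightarrow> (\<integral>\<omega>. F (path01 Y \<omega>) \<partial>M'))"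

section \<open>Wiener processes and functions of bounded variation\<close>

text \<open>The time set \<open>T\<close> is \<open>[0,1]\<close> or \<open>[0,\<infinity>)\<close> in the applications.\<close>

definition wiener_process_on :: "real set \<Rightarrow> 'a measure \<Rightarrow> (real \<Rightarrow> 'a \<Rightarrow> real) \<Rightarrow> bool" where
  "wiener_process_on T M W \<longleftrightarrow>
     prob_space M \<and>
     (\<forall>t\<in>T. W t \<in> borel_measurable M) \<and>
     (AE \<omega> in M. W 0 \<omega> = 0) \<and>
     (\<forall>s\<in>T. \<forall>t\<in>T. s < t \<longrightarrow>
        distributed M lborel (\<lambda>\<omega>. W t \<omega> - W s \<omega>) (normal_density 0 (sqrt (t - s)))) \<and>
     (\<forall>n. \<forall>\<tau> :: nat \<Rightarrow> real. strict_mono_on {..n} \<tau> \<and> \<tau> ` {..n} \<subseteq> T \<longrightarrow>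
        prob_space.indep_vars M (\<lambda>_. borel) (\<lambda>i \<omega>. W (\<tau> (Suc i)) \<omega> - W (\<tau> i) \<omega>) {..<n}) \<and>
     (\<forall>\<omega>\<in>space M. continuous_on T (\<lambda>t. W t \<omega>))"

definition bounded_variation_on :: "real \<Rightarrow> real \<Rightarrow> (real \<Rightarrow> real) \<Rightarrow> bool" where
  "bounded_variation_on a b f \<longleftrightarrow>
     (\<exists>V. \<forall>n. \<forall>\<tau> :: nat \<Rightarrow> real. strict_mono_on {..n} \<tau> \<and> \<tau> 0 = a \<and> \<tau> n = b \<longrightarrow>
        (\<Sum>i<n. \<bar>f (\<tau> (Suc i)) - f (\<tau> i)\<bar>) \<le> V)"

end

theory Submission
  imports Defs
begin

text \<open>
  Let \<open>S\<^sub>N\<close> be the normalized partial sums of the \<open>e\<^sub>l\<close> and \<open>Z\<^sub>N\<close> those of the \<open>u\<^sub>l\<close>. Since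
  \<open>e\<^sub>l / \<surd>N\<close> is the increment of \<open>S\<^sub>N\<close> over \<open>[(l - 1)/N, l/N]\<close>, the path of \<open>Z\<^sub>N\<close> is a deterministic
  function of the path of \<open>S\<^sub>N\<close>: it is the discrete Stieltjes integral
  \<open>I\<^sub>N(g)(t) = \<Sum>\<^sub>l a(l/N) (g(l/N) - g((l - 1)/N))\<close>, \<open>l \<le> N t\<close>, of \<open>a\<close> against \<open>g = S\<^sub>N\<close>.

  Bounded variation of \<open>a\<close> makes this integral stable. If \<open>a\<close> is frozen on the blocks of a coarse
  grid of mesh \<open>1/m\<close>, summation by parts inside each block shows that the integral changes by at most
  the total variation of \<open>a\<close> times the oscillation of \<open>g\<close> over times \<open>2/m\<close>; and the frozen integral
  depends on only a few values of \<open>g\<close>. Hence \<open>I\<^sub>N(g)\<close> is uniformly Cauchy as \<open>N \<rightarrow> \<infinity>\<close> and \<open>g\<close> tends to a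
  continuous path (\<open>discrete_integral_near_continuous\<close>), and the paths of \<open>\<sigma> W\<^sub>0\<close> are continuous. For a
  bounded Lipschitz functional \<open>F\<close> the numbers \<open>F(I\<^sub>N(g))\<close> therefore converge, and a continuous mapping
  theorem for sequences of maps (\<open>extended_continuous_mapping\<close>) gives
  \<open>E F(Z\<^sub>N) \<rightarrow> E (lim\<^sub>n F(I\<^sub>n(\<sigma> W\<^sub>0)))\<close>. Working with the real numbers \<open>F(I\<^sub>n(g))\<close> avoids
  constructing the limiting stochastic integral as a random element.

  The limit is identified along the grids of mesh \<open>1/m\<close>: \<open>I\<^sub>m(\<sigma> W\<^sub>0)\<close> is a step path whose jumps
  are independent and normal with variances \<open>\<sigma>\<^sup>2 a(j/m)\<^sup>2 / m\<close>, and so is \<open>W\<close> observed at the partial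
  sums of these variances (\<open>expectation_weighted_increments_eq_time_changed\<close>, after zero values of \<open>a\<close> have
  been perturbed slightly). Those partial sums are Riemann sums for the integral \<open>b\<close> and converge to it
  uniformly, because \<open>a\<^sup>2\<close> has bounded variation too; by continuity of
  the paths of \<open>W\<close> the limit is \<open>E F(W \<circ> b)\<close>. Finally the continuous mapping theorem, applied to
  the constant sequence \<open>F\<close>, passes from Lipschitz to arbitrary bounded continuous functionals.
\<close>

section \<open>Step paths in the Skorokhod space\<close>

definition to_D01 :: "(real \<Rightarrow> real) \<Rightarrow> skorokhod01" where
  "to_D01 f = Skorokhod01 (restrict f {0..1})"

text \<open>Step paths are described by their values on the grid or, in \<open>sum_path\<close>, by their jumps. The first
  form also covers paths with a nonzero starting value.\<close>

definition step_path :: "nat \<Rightarrow> (nat \<Rightarrow> real) \<Rightarrow> real \<Rightarrow> real" where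
  "step_path N y t = y (nat \<lfloor>real N * t\<rfloor>)"

definition sum_path :: "nat \<Rightarrow> (nat \<Rightarrow> real) \<Rightarrow> real \<Rightarrow> real" where
  "sum_path N x t = (\<Sum>l<nat \<lfloor>real N * t\<rfloor>. x l)"

lemma sum_path_eq_step_path: "sum_path N x = step_path N (\<lambda>k. \<Sum>l<k. x l)"
  by (simp add: sum_path_def step_path_def fun_eq_iff)

lemma path01_eq: "path01 X \<omega> = to_D01 (\<lambda>t. X t \<omega>)"
  by (simp add: path01_def to_D01_def)

lemma apply_to_D01:
  assumes "cadlag_on_01 f" "t \<in> {0..1}"
  shows "apply_skorokhod01 (to_D01 f) t = f t"
proof -
  have "cadlag_on_01 (restrict f {0..1})"
    using assms(1) by (subst cadlag_on_01_cong[where g = f]) auto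
  then show ?thesis
    using assms(2) by (simp add: to_D01_def Skorokhod01_inverse)
qed

lemma to_D01_cong: "(\<And>t. t \<in> {0..1} \<Longrightarrow> f t = g t) \<Longrightarrow> to_D01 f = to_D01 g"
  unfolding to_D01_def by (metis restrict_ext)

lemma dist_to_D01_le:
  assumes "cadlag_on_01 f" "cadlag_on_01 g" "\<And>t. t \<in> {0..1} \<Longrightarrow> \<bar>f t - g t\<bar> \<le> \<epsilon>"
  shows "dist (to_D01 f) (to_D01 g) \<le> \<epsilon>"
  unfolding dist_skorokhod01_def
proof (rule cInf_lower)
  have "0 \<le> \<epsilon>" using assms(3)[of 0] by simp
  then show "\<epsilon> \<in> {\<epsilon>. skorokhod_close \<epsilon> (apply_skorokhod01 (to_D01 f)) (apply_skorokhod01 (to_D01 g))}"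
    using assms time_change01_id
    by (auto simp: skorokhod_close_def apply_to_D01 intro!: exI[of _ "\<lambda>t. t"])
qed (auto intro!: bdd_belowI[of _ 0] dest: skorokhod_close_nonneg)

lemma dist_skorokhod01_less_imp_close:
  assumes "dist x y < \<delta>"
  shows "skorokhod_close \<delta> (apply_skorokhod01 x) (apply_skorokhod01 y)"
proof -
  have "cadlag_on_01 (apply_skorokhod01 z)" for z using apply_skorokhod01[of z] by auto
  then have "{e. skorokhod_close e (apply_skorokhod01 x) (apply_skorokhod01 y)} \<noteq> {}"
    using ex_skorokhod_close[of "apply_skorokhod01 x" "apply_skorokhod01 y"] by simp
  from cInf_lessD[OF this assms[unfolded dist_skorokhod01_def]]
  obtain e where e: "e < \<delta>" "skorokhod_close e (apply_skorokhod01 x) (apply_skorokhod01 y)"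
    by auto
  then obtain \<mu> where "time_change01 \<mu>"
      "\<forall>t\<in>{0..1}. \<bar>\<mu> t - t\<bar> \<le> e \<and> \<bar>apply_skorokhod01 x t - apply_skorokhod01 y (\<mu> t)\<bar> \<le> e"
    unfolding skorokhod_close_def by blast
  then show ?thesis
    unfolding skorokhod_close_def using e(1) by (intro exI[of _ \<mu>]) fastforce
qed

text \<open>Near a continuous path the Skorokhod metric controls the uniform distance: the time change
  costs at most the modulus of continuity of the centre.\<close>

lemma uniformly_close_if_dist_small:
  assumes f: "continuous_on {0..1} (apply_skorokhod01 y)" and "\<epsilon> > 0"
  obtains \<delta> where "\<delta> > 0"
    "\<And>x t. dist x y < \<delta> \<Longrightarrow> t \<in> {0..1} \<Longrightarrow> \<bar>apply_skorokhod01 x t - apply_skorokhod01 y t\<bar> \<le> \<epsilon>"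
proof -
  have "uniformly_continuous_on {0..1} (apply_skorokhod01 y)"
    using f by (intro compact_uniformly_continuous) auto
  then obtain d where d: "d > 0" "\<And>s t. s \<in> {0..1} \<Longrightarrow> t \<in> {0..1} \<Longrightarrow> dist s t < d \<Longrightarrow>
      dist (apply_skorokhod01 y s) (apply_skorokhod01 y t) < \<epsilon> / 2"
    unfolding uniformly_continuous_on_def using half_gt_zero[OF \<open>\<epsilon> > 0\<close>] by metis
  show thesis
  proof (rule that)
    show "min (d / 2) (\<epsilon> / 2) > 0" using d \<open>\<epsilon> > 0\<close> by simp
    fix x t assume "dist x y < min (d / 2) (\<epsilon> / 2)" and t: "t \<in> {0..1::real}"
    then obtain \<mu> where \<mu>: "time_change01 \<mu>" "\<bar>\<mu> t - t\<bar> \<le> min (d / 2) (\<epsilon> / 2)"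
        "\<bar>apply_skorokhod01 x t - apply_skorokhod01 y (\<mu> t)\<bar> \<le> min (d / 2) (\<epsilon> / 2)"
      using dist_skorokhod01_less_imp_close[of x y] unfolding skorokhod_close_def by blast
    have "dist (apply_skorokhod01 y (\<mu> t)) (apply_skorokhod01 y t) < \<epsilon> / 2"
      using d t \<mu> time_change01_mem[OF \<mu>(1) t] by (intro d) (auto simp: dist_real_def)
    then show "\<bar>apply_skorokhod01 x t - apply_skorokhod01 y t\<bar> \<le> \<epsilon>"
      using \<mu>(3) unfolding dist_real_def by linarith
  qed
qed

lemma cadlag_continuous_on:
  assumes "continuous_on {0..1} f"
  shows "cadlag_on_01 f"
  unfolding cadlag_on_01_def
proof (intro conjI ballI)
  fix t :: real assume "t \<in> {0..<1}"
  then show "(f \<longlongrightarrow> f t) (at_right t)"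
    using continuous_on_Icc_at_rightD[of t 1 f] continuous_on_subset[OF assms, of "{t..1}"] by simp
next
  fix t :: real assume "t \<in> {0<..1}"
  then show "\<exists>l. (f \<longlongrightarrow> l) (at_left t)"
    using continuous_on_Icc_at_leftD[of 0 t f] continuous_on_subset[OF assms, of "{0..t}"] by auto
qed

lemma apply_path01_continuous:
  assumes "continuous_on {0..1} (\<lambda>t. Y t \<omega>)"
  shows "continuous_on {0..1} (apply_skorokhod01 (path01 Y \<omega>))"
  using assms by (rule continuous_on_eq) (simp add: path01_eq apply_to_D01 cadlag_continuous_on assms)

lemma cadlag_step_path: "cadlag_on_01 (step_path N y)"
proof (cases "N = 0")
  case True
  then show ?thesis by (auto simp: cadlag_on_01_def step_path_def[abs_def])
next
  case False
  then have N: "real N > 0" by simp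
  show ?thesis unfolding cadlag_on_01_def
  proof (intro conjI ballI)
    fix t :: real
    have "t < (real_of_int \<lfloor>real N * t\<rfloor> + 1) / real N"
      unfolding pos_less_divide_eq[OF N] mult.commute[of t] by linarith
    moreover have "\<lfloor>real N * s\<rfloor> = \<lfloor>real N * t\<rfloor>" if "t < s" "s < (real_of_int \<lfloor>real N * t\<rfloor> + 1) / real N" for s
    proof -
      have "real N * t < real N * s" "real N * s < real_of_int \<lfloor>real N * t\<rfloor> + 1"
        using that unfolding pos_less_divide_eq[OF N] pos_divide_less_eq[OF N] mult.commute[of s]
        using N by simp_all
      then show ?thesis by linarith
    qed
    ultimately have "\<forall>\<^sub>F s in at_right t. step_path N y s = step_path N y t"
      unfolding eventually_at_right_field step_path_def by (intro exI[of _ "(real_of_int \<lfloor>real N * t\<rfloor> + 1) / real N"]) auto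
    then show "(step_path N y \<longlongrightarrow> step_path N y t) (at_right t)"
      by (rule tendsto_eventually)
  next
    fix t :: real
    have "(real_of_int \<lceil>real N * t\<rceil> - 1) / real N < t"
      unfolding pos_divide_less_eq[OF N] mult.commute[of t] by linarith
    moreover have "\<lfloor>real N * s\<rfloor> = \<lceil>real N * t\<rceil> - 1" if "s < t" "(real_of_int \<lceil>real N * t\<rceil> - 1) / real N < s" for s
    proof -
      have "real N * s < real N * t" "real_of_int \<lceil>real N * t\<rceil> - 1 < real N * s"
        using that unfolding pos_less_divide_eq[OF N] pos_divide_less_eq[OF N] mult.commute[of s]
        using N by simp_all
      then show ?thesis by linarith
    qed
    ultimately have "\<forall>\<^sub>F s in at_left t. step_path N y s = y (nat (\<lceil>real N * t\<rceil> - 1))"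
      unfolding eventually_at_left_field step_path_def by (intro exI[of _ "(real_of_int \<lceil>real N * t\<rceil> - 1) / real N"]) auto
    then show "\<exists>l. (step_path N y \<longlongrightarrow> l) (at_left t)"
      by (blast intro: tendsto_eventually)
  qed
qed

lemma cadlag_sum_path: "cadlag_on_01 (sum_path N x)"
  by (simp add: sum_path_eq_step_path cadlag_step_path)

lemma floor_le_grid: "t \<in> {0..1} \<Longrightarrow> nat \<lfloor>real N * t\<rfloor> \<le> N"
  using mult_left_le[of t "real N"] by (simp; linarith)

lemma dist_step_path_le:
  assumes "\<And>k. k \<le> N \<Longrightarrow> \<bar>y k - z k\<bar> \<le> \<epsilon>"
  shows "dist (to_D01 (step_path N y)) (to_D01 (step_path N z)) \<le> \<epsilon>"
  using assms floor_le_grid by (intro dist_to_D01_le cadlag_step_path) (simp add: step_path_def)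

text \<open>The continuity, for the product topology on sequences, turns coordinatewise measurability into Borel
  measurability of the random path.\<close>

lemma continuous_step_path: "continuous_on UNIV (\<lambda>y. to_D01 (step_path N y))"
  unfolding continuous_on_def
proof (intro ballI)
  fix x :: "nat \<Rightarrow> real"
  have "continuous_on UNIV (\<lambda>y::nat \<Rightarrow> real. y l)" for l
    by (rule continuous_on_product_coordinates)
  then have coord: "((\<lambda>y. y l) \<longlongrightarrow> x l) (at x)" for l
    unfolding continuous_on_def by simp
  have "((\<lambda>y. \<Sum>l\<le>N. \<bar>y l - x l\<bar>) \<longlongrightarrow> (\<Sum>l\<le>N. \<bar>x l - x l\<bar>)) (at x)"
    by (intro tendsto_sum tendsto_rabs tendsto_diff tendsto_const coord)
  then have lim: "((\<lambda>y. \<Sum>l\<le>N. \<bar>y l - x l\<bar>) \<longlongrightarrow> 0) (at x)" by simp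
  have "dist (to_D01 (step_path N y)) (to_D01 (step_path N x)) \<le> (\<Sum>l\<le>N. \<bar>y l - x l\<bar>)" for y
    by (intro dist_step_path_le member_le_sum) auto
  then have "((\<lambda>y. dist (to_D01 (step_path N y)) (to_D01 (step_path N x))) \<longlongrightarrow> 0) (at x)"
    by (intro Lim_null_comparison[OF always_eventually lim]) simp
  then show "((\<lambda>y. to_D01 (step_path N y)) \<longlongrightarrow> to_D01 (step_path N x)) (at x within UNIV)"
    by (simp add: tendsto_dist_iff[where f = "\<lambda>y. to_D01 (step_path N y)"])
qed

lemma dist_sum_path_le_sum:
  "dist (to_D01 (sum_path N x)) (to_D01 (sum_path N y)) \<le> (\<Sum>l<N. \<bar>x l - y l\<bar>)"
  unfolding sum_path_eq_step_path
proof (rule dist_step_path_le)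
  fix k assume "k \<le> N"
  have "\<bar>(\<Sum>l<k. x l) - (\<Sum>l<k. y l)\<bar> \<le> (\<Sum>l<k. \<bar>x l - y l\<bar>)"
    by (simp add: sum_subtractf[symmetric] sum_abs)
  also have "\<dots> \<le> (\<Sum>l<N. \<bar>x l - y l\<bar>)" using \<open>k \<le> N\<close> by (intro sum_mono2) auto
  finally show "\<bar>(\<Sum>l<k. x l) - (\<Sum>l<k. y l)\<bar> \<le> (\<Sum>l<N. \<bar>x l - y l\<bar>)" .
qed

lemma sum_path_at_grid:
  assumes "N > 0"
  shows "sum_path N x (real k / real N) = (\<Sum>l<k. x l)"
  using assms by (simp add: sum_path_def)

lemma normalized_partial_sum:
  "1 / sqrt (real N) * (\<Sum>l = 1..nat \<lfloor>real N * t\<rfloor>. z l) = sum_path N (\<lambda>l. z (Suc l) / sqrt (real N)) t"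
  by (simp add: sum_path_def sum.atLeast1_atMost_eq sum_divide_distrib)

lemma measurable_step_path:
  assumes "\<And>l. (\<lambda>\<omega>. y \<omega> l) \<in> borel_measurable M"
  shows "(\<lambda>\<omega>. to_D01 (step_path N (y \<omega>))) \<in> borel_measurable M"
  using assms
  by (intro measurable_compose[OF _ borel_measurable_continuous_onI[OF continuous_step_path]]
      measurable_coordinatewise_then_product)

lemma measurable_sum_path:
  assumes [measurable]: "\<And>l. (\<lambda>\<omega>. x \<omega> l) \<in> borel_measurable M"
  shows "(\<lambda>\<omega>. to_D01 (sum_path N (x \<omega>))) \<in> borel_measurable M"
  unfolding sum_path_eq_step_path by (rule measurable_step_path) measurable

text \<open>This gives both the sampling of a continuous path on a fine grid (\<open>\<phi>\<close> the identity) and the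
  convergence of a path run by a discrete clock \<open>\<gamma>\<close> to the path run by its limit \<open>\<phi>\<close>. The convergence
  of the paths is uniform, by uniform continuity of \<open>g\<close> on the range of the clocks.\<close>

lemma tendsto_step_path_time_change:
  assumes g: "continuous_on {0..B} g" and \<phi>: "continuous_on {0..1} \<phi>" "\<And>t. t \<in> {0..1} \<Longrightarrow> \<phi> t \<in> {0..B}"
    and \<gamma>: "\<And>m t. m > 0 \<Longrightarrow> t \<in> {0..1} \<Longrightarrow> \<gamma> m (nat \<lfloor>real m * t\<rfloor>) \<in> {0..B}"
    and near: "\<And>m t. m > 0 \<Longrightarrow> t \<in> {0..1} \<Longrightarrow> \<bar>\<gamma> m (nat \<lfloor>real m * t\<rfloor>) - \<phi> t\<bar> \<le> C / real m"
  shows "(\<lambda>m. to_D01 (step_path m (\<lambda>k. g (\<gamma> m k)))) \<longlonglongrightarrow> to_D01 (\<lambda>t. g (\<phi> t))"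
proof (rule metric_LIMSEQ_I)
  fix r :: real assume r: "r > 0"
  have cad: "cadlag_on_01 (\<lambda>t. g (\<phi> t))"
    by (intro cadlag_continuous_on continuous_on_compose2[OF g \<phi>(1)]) (use \<phi>(2) in auto)
  have "uniformly_continuous_on {0..B} g"
    using g by (intro compact_uniformly_continuous) auto
  then obtain d where d: "d > 0"
      "\<And>s t. s \<in> {0..B} \<Longrightarrow> t \<in> {0..B} \<Longrightarrow> dist t s < d \<Longrightarrow> dist (g t) (g s) < r / 2"
    unfolding uniformly_continuous_on_def using half_gt_zero[OF r] by metis
  obtain n :: nat where n: "\<bar>C\<bar> / d < real n" using reals_Archimedean2 by blast
  have "dist (to_D01 (step_path m (\<lambda>k. g (\<gamma> m k)))) (to_D01 (\<lambda>t. g (\<phi> t))) < r" if m: "m \<ge> Suc n" for m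
  proof -
    have m0: "m > 0" "real m > 0" using m by auto
    have "real n < real m" using m by simp
    then have "\<bar>C\<bar> / d < real m" using n by linarith
    then have "\<bar>C\<bar> / real m < d" using d(1) m0 by (simp add: field_simps)
    moreover have "C / real m \<le> \<bar>C\<bar> / real m" using m0 by (simp add: divide_right_mono)
    ultimately have Cm: "C / real m < d" by linarith
    have "dist (to_D01 (step_path m (\<lambda>k. g (\<gamma> m k)))) (to_D01 (\<lambda>t. g (\<phi> t))) \<le> r / 2"
    proof (intro dist_to_D01_le cadlag_step_path cad)
      fix t :: real assume t: "t \<in> {0..1}"
      have "dist (\<gamma> m (nat \<lfloor>real m * t\<rfloor>)) (\<phi> t) < d"
        using near[OF m0(1) t] Cm unfolding dist_real_def by linarith
      then have "dist (g (\<gamma> m (nat \<lfloor>real m * t\<rfloor>))) (g (\<phi> t)) < r / 2"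
        using \<gamma>[OF m0(1) t] \<phi>(2)[OF t] by (intro d(2))
      then show "\<bar>step_path m (\<lambda>k. g (\<gamma> m k)) t - g (\<phi> t)\<bar> \<le> r / 2"
        by (simp add: step_path_def dist_real_def)
    qed
    then show ?thesis using r by linarith
  qed
  then show "\<exists>n. \<forall>m\<ge>n. dist (to_D01 (step_path m (\<lambda>k. g (\<gamma> m k)))) (to_D01 (\<lambda>t. g (\<phi> t))) < r"
    by blast
qed

lemma tendsto_step_path_grid:
  assumes "continuous_on {0..1} f"
  shows "(\<lambda>m. to_D01 (step_path m (\<lambda>k. f (real k / real m)))) \<longlonglongrightarrow> to_D01 f"
proof -
  have *: "0 \<le> real (nat \<lfloor>real m * t\<rfloor>) / real m" "real (nat \<lfloor>real m * t\<rfloor>) / real m \<le> t"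
    "t \<le> real (nat \<lfloor>real m * t\<rfloor>) / real m + 1 / real m" if "m > 0" "t \<in> {0..1}" for m t
    using that by (simp_all add: pos_divide_le_eq add_divide_distrib[symmetric] pos_le_divide_eq mult.commute[of t])
  show ?thesis
  proof (rule tendsto_step_path_time_change[where B = 1 and C = 1, OF assms continuous_on_id])
    fix m :: nat and t :: real assume m: "m > 0" and t: "t \<in> {0..1}"
    have "real (nat \<lfloor>real m * t\<rfloor>) / real m \<le> 1" using *(2)[OF m t] t by simp
    then show "real (nat \<lfloor>real m * t\<rfloor>) / real m \<in> {0..1}" using *(1)[OF m t] by simp
    show "\<bar>real (nat \<lfloor>real m * t\<rfloor>) / real m - t\<bar> \<le> 1 / real m"
      using *(2,3)[OF m t] by linarith
  qed
qed

text \<open>The Borel sets of \<open>\<D>[0,1]\<close> are not defined by coordinates; measurability of the path map comes from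
  writing it as a limit of step paths, each a continuous function of finitely many coordinates.\<close>

lemma random_element_continuous_process:
  assumes "prob_space M" and Y [measurable]: "\<And>t. 0 \<le> t \<Longrightarrow> Y t \<in> borel_measurable M"
    and cont: "\<And>\<omega>. \<omega> \<in> space M \<Longrightarrow> continuous_on {0..1} (\<lambda>t. Y t \<omega>)"
  shows "random_element_D01 M Y"
proof -
  have "path01 Y \<in> borel_measurable M"
    unfolding path01_eq[abs_def]
  proof (rule borel_measurable_LIMSEQ_metric)
    fix m
    show "(\<lambda>\<omega>. to_D01 (step_path m (\<lambda>k. Y (real k / real m) \<omega>))) \<in> borel_measurable M"
      by (rule measurable_step_path) (simp add: Y)
  qed (rule tendsto_step_path_grid[OF cont])
  then show ?thesis
    using assms(1) cont by (simp add: random_element_D01_def cadlag_continuous_on)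
qed

section \<open>An extended continuous mapping theorem\<close>

lemma lipschitz_imp_continuous:
  fixes F :: "'s::metric_space \<Rightarrow> real"
  assumes "\<And>x y. \<bar>F x - F y\<bar> \<le> L * dist x y"
  shows "continuous_on UNIV F"
proof (rule lipschitz_on_continuous_on[where L = "\<bar>L\<bar>"], rule lipschitz_onI)
  fix x y :: 's
  have "L * dist x y \<le> \<bar>L\<bar> * dist x y" by (intro mult_right_mono) auto
  then show "dist (F x) (F y) \<le> \<bar>L\<bar> * dist x y" using assms[of x y] by (simp add: dist_real_def)
qed simp

text \<open>One half of the continuous mapping theorem below. The functions \<open>G n\<close> with \<open>n \<ge> k\<close> are replaced by their
  upper envelope \<open>H k s = sup {G n g - k d(s,g) | n \<ge> k, g}\<close>. It dominates them, it is \<open>k\<close>-Lipschitz, so that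
  weak convergence applies to it, and it decreases to \<open>G'\<close> at the values of \<open>Y\<close>: there the penalty forces
  \<open>g\<close> close to \<open>s\<close>, where the \<open>G n\<close> are close to \<open>G'\<close>.\<close>

lemma eventually_integral_le:
  fixes X :: "nat \<Rightarrow> 'a \<Rightarrow> 's::metric_space" and Y :: "'b \<Rightarrow> 's" and G :: "nat \<Rightarrow> 's \<Rightarrow> real"
  assumes M: "prob_space M" and M': "prob_space M'"
    and X [measurable]: "\<And>n. X n \<in> borel_measurable M" and Y [measurable]: "Y \<in> borel_measurable M'"
    and bound: "\<And>n s. \<bar>G n s\<bar> \<le> B"
    and G_meas [measurable]: "\<And>n. (\<lambda>\<omega>. G n (X n \<omega>)) \<in> borel_measurable M"
    and lip: "\<And>H L. \<forall>s t. \<bar>H s - H t\<bar> \<le> L * dist s t \<Longrightarrow> bounded (range H) \<Longrightarrow>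
        (\<lambda>n. \<integral>\<omega>. H (X n \<omega>) \<partial>M) \<longlonglongrightarrow> (\<integral>\<omega>. H (Y \<omega>) \<partial>M')"
    and conv: "\<And>\<omega> \<epsilon>. \<omega> \<in> space M' \<Longrightarrow> \<epsilon> > 0 \<Longrightarrow>
        \<exists>\<delta>>0. \<exists>K. \<forall>n\<ge>K. \<forall>s. dist s (Y \<omega>) < \<delta> \<longrightarrow> \<bar>G n s - G' (Y \<omega>)\<bar> \<le> \<epsilon>"
    and "\<epsilon> > 0"
  shows "\<forall>\<^sub>F n in sequentially. (\<integral>\<omega>. G n (X n \<omega>) \<partial>M) \<le> (\<integral>\<omega>. G' (Y \<omega>) \<partial>M') + \<epsilon>"
proof -
  interpret M: prob_space M by fact
  interpret M': prob_space M' by fact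
  define A where "A k s = {G n g - real k * dist s g | n g. n \<ge> k}" for k s
  define H where "H k s = Sup (A k s)" for k s
  have B: "0 \<le> B" using bound[of 0 undefined] by linarith
  have A_le: "z \<le> B" if "z \<in> A k s" for z k s
    using that bound unfolding A_def by (auto simp: abs_le_iff) (smt (verit) mult_nonneg_nonneg of_nat_0_le_iff zero_le_dist)
  then have bdd: "bdd_above (A k s)" for k s by (rule bdd_aboveI)
  have mem: "G n g - real k * dist s g \<in> A k s" if "n \<ge> k" for n g k s using that by (auto simp: A_def)
  have ne: "A k s \<noteq> {}" for k s using mem[of k k] by blast
  have H_le: "H k s \<le> B" for k s unfolding H_def by (rule cSup_least[OF ne A_le])
  have H_ge: "G n g - real k * dist s g \<le> H k s" if "n \<ge> k" for n g k s
    unfolding H_def by (rule cSup_upper[OF mem[OF that] bdd])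
  have G_le_H: "G n s \<le> H k s" if "n \<ge> k" for n k s using H_ge[OF that, of s s] by simp
  have H_abs: "\<bar>H k s\<bar> \<le> B" for k s
    using H_le[of k s] G_le_H[of k k s] bound[of k s] by linarith
  have H_lip1: "H k s \<le> H k t + real k * dist s t" for k s t
    unfolding H_def
  proof (rule cSup_least[OF ne])
    fix z assume "z \<in> A k s"
    then obtain n g where ng: "n \<ge> k" "z = G n g - real k * dist s g" by (auto simp: A_def)
    have "dist t g \<le> dist s t + dist s g" by (metis dist_commute dist_triangle add.commute)
    then have "real k * dist t g \<le> real k * dist s t + real k * dist s g"
      by (metis distrib_left mult_left_mono of_nat_0_le_iff)
    then show "z \<le> Sup (A k t) + real k * dist s t" using H_ge[OF ng(1), of g t] ng(2) by (simp add: H_def)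
  qed
  have H_lip: "\<forall>s t. \<bar>H k s - H k t\<bar> \<le> real k * dist s t" for k
  proof (intro allI)
    fix s t show "\<bar>H k s - H k t\<bar> \<le> real k * dist s t"
      using H_lip1[of k s t] H_lip1[of k t s] by (simp add: dist_commute abs_le_iff)
  qed
  have H_cont: "continuous_on UNIV (H k)" for k
    by (rule lipschitz_imp_continuous[OF H_lip[rule_format]])
  have H_meas [measurable]: "H k \<in> borel_measurable borel" for k
    by (rule borel_measurable_continuous_onI[OF H_cont])
  have H_lim: "(\<lambda>k. H k (Y \<omega>)) \<longlonglongrightarrow> G' (Y \<omega>)" if \<omega>: "\<omega> \<in> space M'" for \<omega>
  proof (rule LIMSEQ_I)
    fix r :: real assume "r > 0"
    then obtain \<delta> K where \<delta>: "\<delta> > 0"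
        and K: "\<And>n s. n \<ge> K \<Longrightarrow> dist s (Y \<omega>) < \<delta> \<Longrightarrow> \<bar>G n s - G' (Y \<omega>)\<bar> \<le> r / 2"
      using conv[OF \<omega>, of "r / 2"] by auto
    obtain K' :: nat where K': "2 * B / \<delta> < real K'" using reals_Archimedean2 by blast
    have "norm (H k (Y \<omega>) - G' (Y \<omega>)) < r" if k: "k \<ge> max K K'" for k
    proof -
      have near: "\<bar>G k (Y \<omega>) - G' (Y \<omega>)\<bar> \<le> r / 2" by (rule K) (use k \<delta> in auto)
      have "H k (Y \<omega>) \<le> G' (Y \<omega>) + r / 2"
        unfolding H_def
      proof (rule cSup_least[OF ne])
        fix z assume "z \<in> A k (Y \<omega>)"
        then obtain n g where ng: "n \<ge> k" "z = G n g - real k * dist (Y \<omega>) g" by (auto simp: A_def)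
        show "z \<le> G' (Y \<omega>) + r / 2"
        proof (cases "dist g (Y \<omega>) < \<delta>")
          case True
          then have "\<bar>G n g - G' (Y \<omega>)\<bar> \<le> r / 2" by (intro K) (use k ng in auto)
          moreover have "0 \<le> real k * dist (Y \<omega>) g" by simp
          ultimately show ?thesis using ng(2) by linarith
        next
          case False
          \<comment> \<open>Far from \<open>Y \<omega>\<close> the penalty exceeds the whole range \<open>2 * B\<close> of the functions.\<close>
          have "2 * B \<le> real K' * \<delta>" using K' \<delta> by (simp add: field_simps)
          also have "\<dots> \<le> real k * dist (Y \<omega>) g"
            using k False \<delta> by (intro mult_mono) (auto simp: dist_commute)
          finally show ?thesis using ng(2) bound[of n g] bound[of k "Y \<omega>"] near by linarith
        qed
      qed
      moreover have "G' (Y \<omega>) - r / 2 \<le> H k (Y \<omega>)" using near G_le_H[of k k "Y \<omega>"] by linarith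
      ultimately show ?thesis using \<open>r > 0\<close> by (simp add: abs_less_iff)
    qed
    then show "\<exists>k0. \<forall>k\<ge>k0. norm (H k (Y \<omega>) - G' (Y \<omega>)) < r" by blast
  qed
  have G'_meas [measurable]: "(\<lambda>\<omega>. G' (Y \<omega>)) \<in> borel_measurable M'"
    by (rule borel_measurable_LIMSEQ_metric[OF _ H_lim]) measurable
  have "(\<lambda>k. \<integral>\<omega>. H k (Y \<omega>) \<partial>M') \<longlonglongrightarrow> (\<integral>\<omega>. G' (Y \<omega>) \<partial>M')"
    by (rule integral_dominated_convergence[where w = "\<lambda>_. B"]) (use H_lim H_abs in auto)
  then have "\<forall>\<^sub>F k in sequentially. (\<integral>\<omega>. H k (Y \<omega>) \<partial>M') < (\<integral>\<omega>. G' (Y \<omega>) \<partial>M') + \<epsilon>"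
    using \<open>\<epsilon> > 0\<close> by (intro order_tendstoD) auto
  then obtain k where k: "(\<integral>\<omega>. H k (Y \<omega>) \<partial>M') < (\<integral>\<omega>. G' (Y \<omega>) \<partial>M') + \<epsilon>"
    by (auto simp: eventually_sequentially)
  have "bounded (range (H k))" using H_abs by (auto simp: bounded_iff)
  then have "\<forall>\<^sub>F n in sequentially. (\<integral>\<omega>. H k (X n \<omega>) \<partial>M) < (\<integral>\<omega>. G' (Y \<omega>) \<partial>M') + \<epsilon>"
    using lip[OF H_lip] k by (metis order_tendstoD(2))
  then show ?thesis
    using eventually_ge_at_top[of k]
  proof eventually_elim
    case (elim n)
    have "(\<integral>\<omega>. G n (X n \<omega>) \<partial>M) \<le> (\<integral>\<omega>. H k (X n \<omega>) \<partial>M)"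
      by (intro integral_mono M.integrable_const_bound[where B = B])
        (use bound H_abs G_le_H[OF elim(2)] in auto)
    then show ?case using elim(1) by linarith
  qed
qed

text \<open>The \<open>G n\<close> may vary with \<open>n\<close> and need converge only at the values of \<open>Y\<close>, locally uniformly there. Weak
  convergence is assumed for Lipschitz test functions alone; with \<open>G n\<close> a fixed continuous function
  the conclusion is then the usual weak convergence.\<close>

theorem extended_continuous_mapping:
  fixes X :: "nat \<Rightarrow> 'a \<Rightarrow> 's::metric_space" and Y :: "'b \<Rightarrow> 's" and G :: "nat \<Rightarrow> 's \<Rightarrow> real"
  assumes M: "prob_space M" and M': "prob_space M'"
    and X: "\<And>n. X n \<in> borel_measurable M" and Y: "Y \<in> borel_measurable M'"
    and bound: "\<And>n s. \<bar>G n s\<bar> \<le> B"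
    and G_meas: "\<And>n. (\<lambda>\<omega>. G n (X n \<omega>)) \<in> borel_measurable M"
    and lip: "\<And>H L. \<forall>s t. \<bar>H s - H t\<bar> \<le> L * dist s t \<Longrightarrow> bounded (range H) \<Longrightarrow>
        (\<lambda>n. \<integral>\<omega>. H (X n \<omega>) \<partial>M) \<longlonglongrightarrow> (\<integral>\<omega>. H (Y \<omega>) \<partial>M')"
    and conv: "\<And>\<omega> \<epsilon>. \<omega> \<in> space M' \<Longrightarrow> \<epsilon> > 0 \<Longrightarrow>
        \<exists>\<delta>>0. \<exists>K. \<forall>n\<ge>K. \<forall>s. dist s (Y \<omega>) < \<delta> \<longrightarrow> \<bar>G n s - G' (Y \<omega>)\<bar> \<le> \<epsilon>"
  shows "(\<lambda>n. \<integral>\<omega>. G n (X n \<omega>) \<partial>M) \<longlonglongrightarrow> (\<integral>\<omega>. G' (Y \<omega>) \<partial>M')"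
proof (rule tendstoI)
  fix r :: real assume r: "r > 0"
  have "\<forall>\<^sub>F n in sequentially. (\<integral>\<omega>. G n (X n \<omega>) \<partial>M) \<le> (\<integral>\<omega>. G' (Y \<omega>) \<partial>M') + r / 2"
    by (rule eventually_integral_le[OF M M' X Y bound G_meas lip conv]) (use r in auto)
  moreover have "\<forall>\<^sub>F n in sequentially. (\<integral>\<omega>. - G n (X n \<omega>) \<partial>M) \<le> (\<integral>\<omega>. - G' (Y \<omega>) \<partial>M') + r / 2"
  proof (rule eventually_integral_le[OF M M' X Y _ _ lip, where G = "\<lambda>n s. - G n s" and G' = "\<lambda>s. - G' s" and B = B])
    fix \<omega> \<epsilon> :: real assume "\<epsilon> > 0"
    fix \<omega> assume "\<omega> \<in> space M'"
    from conv[OF this \<open>\<epsilon> > 0\<close>]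
    show "\<exists>\<delta>>0. \<exists>K. \<forall>n\<ge>K. \<forall>s. dist s (Y \<omega>) < \<delta> \<longrightarrow> \<bar>- G n s - - G' (Y \<omega>)\<bar> \<le> \<epsilon>"
      by (simp add: abs_minus_commute)
  qed (use r bound G_meas in auto)
  ultimately show "\<forall>\<^sub>F n in sequentially. dist (\<integral>\<omega>. G n (X n \<omega>) \<partial>M) (\<integral>\<omega>. G' (Y \<omega>) \<partial>M') < r"
    by eventually_elim (use r in \<open>simp add: dist_real_def abs_less_iff\<close>)
qed

section \<open>Sums with integrators of bounded variation\<close>

text \<open>This form of bounded variation bounds the variation of \<open>a\<close> over a subinterval by a single difference
  of \<open>v\<close>, and such bounds telescope over adjacent intervals.\<close>

definition increments_dominated :: "(real \<Rightarrow> real) \<Rightarrow> (real \<Rightarrow> real) \<Rightarrow> bool" where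
  "increments_dominated a v \<longleftrightarrow>
     (\<forall>x y. 0 \<le> x \<longrightarrow> x \<le> y \<longrightarrow> y \<le> 1 \<longrightarrow> \<bar>a y - a x\<bar> \<le> v y - v x)"

lemma increments_dominatedD:
  "increments_dominated a v \<Longrightarrow> 0 \<le> x \<Longrightarrow> x \<le> y \<Longrightarrow> y \<le> 1 \<Longrightarrow> \<bar>a y - a x\<bar> \<le> v y - v x"
  by (simp add: increments_dominated_def)

lemma increments_dominated_mono:
  "increments_dominated a v \<Longrightarrow> 0 \<le> x \<Longrightarrow> x \<le> y \<Longrightarrow> y \<le> 1 \<Longrightarrow> v x \<le> v y"
  using increments_dominatedD[of a v x y] by simp

lemma increments_dominated_bound:
  assumes "increments_dominated a v" "x \<in> {0..1}"
  shows "\<bar>a x\<bar> \<le> \<bar>a 0\<bar> + (v 1 - v 0)"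
  using increments_dominatedD[OF assms(1), of 0 x] increments_dominated_mono[OF assms(1), of x 1] assms(2)
  by auto

text \<open>The dominating function is the total variation on \<open>[0,x]\<close>: a partition of \<open>[0,x]\<close> extends to one
  of \<open>[0,y]\<close> by the single interval \<open>[x,y]\<close>.\<close>

lemma bounded_variation_increments_dominated:
  assumes "bounded_variation_on 0 1 a"
  obtains v where "increments_dominated a v"
proof -
  define P where "P n \<tau> x \<longleftrightarrow> strict_mono_on {..n} \<tau> \<and> \<tau> 0 = 0 \<and> \<tau> n = x"
    for n and \<tau> :: "nat \<Rightarrow> real" and x
  define S where "S x = {(\<Sum>i<n. \<bar>a (\<tau> (Suc i)) - a (\<tau> i)\<bar>) | n \<tau>. P n \<tau> x}" for x
  obtain V where V: "\<And>n \<tau>. P n \<tau> 1 \<Longrightarrow> (\<Sum>i<n. \<bar>a (\<tau> (Suc i)) - a (\<tau> i)\<bar>) \<le> V"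
    using assms unfolding bounded_variation_on_def P_def by blast
  have ext: "s + \<bar>a y - a x\<bar> \<in> S y" if "s \<in> S x" "x < y" for s x y
  proof -
    from \<open>s \<in> S x\<close> obtain n \<tau> where n: "P n \<tau> x" and s: "s = (\<Sum>i<n. \<bar>a (\<tau> (Suc i)) - a (\<tau> i)\<bar>)"
      by (auto simp: S_def)
    define \<tau>' where "\<tau>' = \<tau>(Suc n := y)"
    have le: "\<tau> i \<le> x" if "i \<le> n" for i
      using n that unfolding P_def by (cases "i = n") (auto dest: strict_mono_onD[of _ _ i n])
    have "strict_mono_on {..Suc n} \<tau>'"
    proof (rule strict_mono_onI)
      fix r q assume "r \<in> {..Suc n}" "q \<in> {..Suc n}" "r < q"
      then show "\<tau>' r < \<tau>' q"
        using n le[of r] \<open>x < y\<close> unfolding P_def \<tau>'_def by (auto intro: strict_mono_onD)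
    qed
    then have "P (Suc n) \<tau>' y" using n by (simp add: P_def \<tau>'_def)
    moreover have "(\<Sum>i<n. \<bar>a (\<tau>' (Suc i)) - a (\<tau>' i)\<bar>) = s"
      unfolding s \<tau>'_def by (intro sum.cong) auto
    then have "s + \<bar>a y - a x\<bar> = (\<Sum>i<Suc n. \<bar>a (\<tau>' (Suc i)) - a (\<tau>' i)\<bar>)"
      using n by (simp add: \<tau>'_def P_def)
    ultimately show ?thesis unfolding S_def by blast
  qed
  have "P 0 (\<lambda>_. 0) 0" by (auto simp: P_def strict_mono_on_def)
  then have S0: "0 \<in> S 0" unfolding S_def by (intro CollectI exI[of _ 0] exI[of _ "\<lambda>_. 0"]) simp
  have ne: "S x \<noteq> {}" if "0 \<le> x" for x using ext[OF S0, of x] S0 that by (cases "x = 0") auto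
  have bdd: "bdd_above (S x)" if "x \<le> 1" for x
  proof (rule bdd_aboveI)
    fix s assume s: "s \<in> S x"
    have S1: "s' \<le> V" if "s' \<in> S 1" for s' using that V by (auto simp: S_def)
    show "s \<le> V"
    proof (cases "x = 1")
      case False
      then show ?thesis using S1[OF ext[OF s, of 1]] that by linarith
    qed (use s S1 in auto)
  qed
  have "\<bar>a y - a x\<bar> \<le> Sup (S y) - Sup (S x)" if "0 \<le> x" "x \<le> y" "y \<le> 1" for x y
  proof (cases "x = y")
    case False
    have "Sup (S x) \<le> Sup (S y) - \<bar>a y - a x\<bar>"
    proof (rule cSup_least[OF ne])
      fix s assume "s \<in> S x"
      then have "s + \<bar>a y - a x\<bar> \<le> Sup (S y)"
        using that False by (intro cSup_upper ext bdd) auto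
      then show "s \<le> Sup (S y) - \<bar>a y - a x\<bar>" by linarith
    qed (use that in auto)
    then show ?thesis by linarith
  qed simp
  then show thesis by (intro that[of "\<lambda>x. Sup (S x)"]) (simp add: increments_dominated_def)
qed

text \<open>Weights of small variation times increments: the sum is the last weight times the total increment, up
  to the variation of the weights times the oscillation of \<open>x\<close>.\<close>

lemma summation_by_parts_bound:
  fixes c x u :: "nat \<Rightarrow> real"
  assumes "p < q"
    and c: "\<And>l. p < l \<Longrightarrow> l < q \<Longrightarrow> \<bar>c (Suc l) - c l\<bar> \<le> u (Suc l) - u l"
    and x: "\<And>l. p \<le> l \<Longrightarrow> l < q \<Longrightarrow> \<bar>x l - x p\<bar> \<le> \<eta>"
  shows "\<bar>(\<Sum>l=p..<q. c (Suc l) * (x (Suc l) - x l)) - c q * (x q - x p)\<bar> \<le> \<eta> * (u q - u (Suc p))"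
proof -
  have "Suc p \<le> q" using \<open>p < q\<close> by simp
  then show ?thesis using c x
  proof (induction q rule: dec_induct)
    case base
    then show ?case by simp
  next
    case (step q)
    let ?T = "\<Sum>l=p..<q. c (Suc l) * (x (Suc l) - x l)"
    have "(\<Sum>l=p..<Suc q. c (Suc l) * (x (Suc l) - x l)) - c (Suc q) * (x (Suc q) - x p)
        = (?T - c q * (x q - x p)) - (c (Suc q) - c q) * (x q - x p)"
      using step.hyps by (simp add: algebra_simps)
    moreover have "\<bar>?T - c q * (x q - x p)\<bar> \<le> \<eta> * (u q - u (Suc p))"
      using step.prems by (intro step.IH) auto
    moreover have "\<bar>(c (Suc q) - c q) * (x q - x p)\<bar> \<le> (u (Suc q) - u q) * \<eta>"
      unfolding abs_mult using step.prems(1)[of q] step.prems(2)[of q] step.hyps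
      by (intro mult_mono) auto
    ultimately show ?case by (simp add: algebra_simps)
  qed
qed

definition discrete_integral :: "(real \<Rightarrow> real) \<Rightarrow> nat \<Rightarrow> (real \<Rightarrow> real) \<Rightarrow> real \<Rightarrow> real" where
  "discrete_integral a N f =
     sum_path N (\<lambda>l. a (real (Suc l) / real N) * (f (real (Suc l) / real N) - f (real l / real N)))"

text \<open>The integral of the step function that takes the value \<open>a(j/m)\<close> on the block \<open>((j - 1)/m, j/m]\<close>. The
  minimum stops the integration at time \<open>t\<close>.\<close>

definition block_integral :: "(real \<Rightarrow> real) \<Rightarrow> nat \<Rightarrow> (real \<Rightarrow> real) \<Rightarrow> real \<Rightarrow> real" where
  "block_integral a m f t =
     (\<Sum>j<m. a (real (Suc j) / real m) * (f (min t (real (Suc j) / real m)) - f (min t (real j / real m))))"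

text \<open>The cost of freezing \<open>a\<close> on one block. The fine grid points in the block are those with index in
  \<open>(P j, P (j + 1)]\<close>; summation by parts is applied to the weights \<open>a(l/N) - a((j + 1)/m)\<close>. Two fine grid points
  relevant to one block are at distance at most \<open>1/m + 1/N \<le> 2/m\<close>.\<close>

lemma block_estimate:
  fixes f g :: "real \<Rightarrow> real"
  assumes av: "increments_dominated a v"
    and mN: "0 < m" "m \<le> N" and t: "t \<in> {0..1}" and j: "j < m"
    and g: "\<And>s. s \<in> {0..1} \<Longrightarrow> \<bar>g s - f s\<bar> \<le> \<eta>"
    and \<omega>: "\<And>s s'. s \<in> {0..1} \<Longrightarrow> s' \<in> {0..1} \<Longrightarrow> \<bar>s - s'\<bar> \<le> 2 / real m \<Longrightarrow> \<bar>f s - f s'\<bar> \<le> \<omega>"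
  defines "P \<equiv> \<lambda>j. nat \<lfloor>real N * min t (real j / real m)\<rfloor>"
    and "x \<equiv> \<lambda>l. g (real l / real N)"
  shows "\<bar>(\<Sum>l=P j..<P (Suc j). a (real (Suc l) / real N) * (x (Suc l) - x l))
      - a (real (Suc j) / real m) * (x (P (Suc j)) - x (P j))\<bar>
      \<le> (2 * \<eta> + \<omega>) * (v (real (Suc j) / real m) - v (real j / real m))"
proof -
  define p q where "p = P j" and "q = P (Suc j)"
  define aj where "aj = a (real (Suc j) / real m)"
  have m0: "real m > 0" and N0: "real N > 0" using mN by auto
  have \<eta>\<omega>: "0 \<le> 2 * \<eta> + \<omega>" using g[of 0] \<omega>[of 0 0] m0 by auto
  have jm: "0 \<le> real j / real m" "real j / real m \<le> real (Suc j) / real m" "real (Suc j) / real m \<le> 1"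
    using j m0 by (auto simp: field_simps)
  define r s where "r = min t (real j / real m)" and "s = min t (real (Suc j) / real m)"
  have rs: "0 \<le> r" "r \<le> s" "s \<le> 1" "s \<le> real (Suc j) / real m" "s - r \<le> 1 / real m"
  proof -
    have "real (Suc j) / real m = real j / real m + 1 / real m" by (simp add: add_divide_distrib)
    moreover have "0 \<le> t" "t \<le> 1" using t by auto
    ultimately show "0 \<le> r" "r \<le> s" "s \<le> 1" "s \<le> real (Suc j) / real m" "s - r \<le> 1 / real m"
      using jm unfolding r_def s_def by linarith+
  qed
  have p: "real p \<le> real N * r" "real N * r < real p + 1"
    and q: "real q \<le> real N * s" "real N * s < real q + 1"
    using rs N0 unfolding p_def q_def P_def r_def[symmetric] s_def[symmetric] by auto
  show ?thesis
  proof (cases "p < q")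
    case False
    have "real N * r \<le> real N * s" using rs by (intro mult_left_mono) auto
    then have "p \<le> q" unfolding p_def q_def P_def r_def s_def by (intro nat_mono floor_mono)
    then have "p = q" using False by simp
    then show ?thesis
      using \<eta>\<omega> increments_dominated_mono[OF av jm] by (simp add: p_def[symmetric] q_def[symmetric])
  next
    case True
    define u where "u l = v (real l / real N)" for l
    define c where "c l = a (real l / real N) - aj" for l
    \<comment> \<open>A nonempty block is not cut off at its left end by the time \<open>t\<close>.\<close>
    have rj: "r = real j / real m"
    proof (rule ccontr)
      assume "r \<noteq> real j / real m"
      then have "r = s" using jm unfolding r_def s_def by auto
      then have "real q < real p + 1" using p q by simp
      then show False using True by linarith
    qed
    have "q \<le> N"
    proof -
      have "real N * s \<le> real N" using rs N0 by simp
      then show ?thesis using q by linarith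
    qed
    have qj: "real q / real N \<le> real (Suc j) / real m"
    proof -
      have "real q / real N \<le> s" using q(1) N0 by (simp add: pos_divide_le_eq mult.commute)
      then show ?thesis using rs(4) by linarith
    qed
    have pj: "real j / real m \<le> real (Suc p) / real N"
      using p(2) N0 unfolding rj by (simp add: pos_le_divide_eq mult.commute)
    have osc: "\<bar>x l - x p\<bar> \<le> 2 * \<eta> + \<omega>" if l: "p \<le> l" "l \<le> q" for l
    proof -
      have "real q - real p \<le> real N * (s - r) + 1" using p q by (simp add: algebra_simps)
      also have "\<dots> \<le> real N * (1 / real m) + real N * (1 / real m)"
        using rs N0 mN by (intro add_mono mult_left_mono) (auto simp: field_simps)
      finally have "real q - real p \<le> real N * (2 / real m)" by (simp add: mult.commute)
      then have "real l - real p \<le> real N * (2 / real m)" using l by linarith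
      then have "(real l - real p) / real N \<le> 2 / real m"
        using N0 by (simp add: pos_divide_le_eq mult.commute)
      then have "\<bar>real l / real N - real p / real N\<bar> \<le> 2 / real m"
        using l N0 by (simp add: diff_divide_distrib[symmetric])
      moreover have in01: "real l / real N \<in> {0..1}" "real p / real N \<in> {0..1}"
        using l \<open>q \<le> N\<close> N0 by (auto simp: field_simps)
      ultimately have "\<bar>f (real l / real N) - f (real p / real N)\<bar> \<le> \<omega>" by (intro \<omega>)
      then show "\<bar>x l - x p\<bar> \<le> 2 * \<eta> + \<omega>"
        using g[OF in01(1)] g[OF in01(2)] unfolding x_def by linarith
    qed
    have step1: "\<bar>(\<Sum>l=p..<q. c (Suc l) * (x (Suc l) - x l)) - c q * (x q - x p)\<bar> \<le> (2 * \<eta> + \<omega>) * (u q - u (Suc p))"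
    proof (rule summation_by_parts_bound[OF True])
      fix l assume "p < l" "l < q"
      then show "\<bar>c (Suc l) - c l\<bar> \<le> u (Suc l) - u l"
        unfolding c_def u_def using increments_dominatedD[OF av, of "real l / real N" "real (Suc l) / real N"] \<open>q \<le> N\<close> N0
        by (simp add: field_simps)
    next
      fix l assume "p \<le> l" "l < q"
      then show "\<bar>x l - x p\<bar> \<le> 2 * \<eta> + \<omega>" by (intro osc) auto
    qed
    have step2: "\<bar>c q * (x q - x p)\<bar> \<le> (v (real (Suc j) / real m) - u q) * (2 * \<eta> + \<omega>)"
      unfolding abs_mult
    proof (intro mult_mono)
      show "\<bar>c q\<bar> \<le> v (real (Suc j) / real m) - u q"
        using increments_dominatedD[OF av _ qj jm(3)] unfolding c_def aj_def u_def
        by (simp add: abs_minus_commute)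
      then show "0 \<le> v (real (Suc j) / real m) - u q" by linarith
      show "\<bar>x q - x p\<bar> \<le> 2 * \<eta> + \<omega>" using True by (intro osc) auto
    qed simp
    have "(\<Sum>l=p..<q. x (Suc l) - x l) = x q - x p"
      using True by (intro sum_Suc_diff') simp
    then have "(\<Sum>l=p..<q. c (Suc l) * (x (Suc l) - x l))
        = (\<Sum>l=p..<q. a (real (Suc l) / real N) * (x (Suc l) - x l)) - aj * (x q - x p)"
      unfolding c_def by (simp only: left_diff_distrib sum_subtractf sum_distrib_left[symmetric])
    moreover have "(2 * \<eta> + \<omega>) * (u q - u (Suc p)) + (v (real (Suc j) / real m) - u q) * (2 * \<eta> + \<omega>)
        \<le> (2 * \<eta> + \<omega>) * (v (real (Suc j) / real m) - v (real j / real m))"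
    proof -
      have "v (real j / real m) \<le> u (Suc p)"
        unfolding u_def using True \<open>q \<le> N\<close> N0 by (intro increments_dominated_mono[OF av jm(1) pj]) (simp add: field_simps)
      then have "(2 * \<eta> + \<omega>) * v (real j / real m) \<le> (2 * \<eta> + \<omega>) * u (Suc p)"
        using \<eta>\<omega> by (rule mult_left_mono)
      then show ?thesis by (simp add: algebra_simps)
    qed
    ultimately show ?thesis
      using step1 step2 unfolding p_def[symmetric] q_def[symmetric] aj_def[symmetric] by linarith
  qed
qed

lemma sum_grouped:
  fixes z :: "nat \<Rightarrow> real"
  assumes "P 0 = 0" "\<And>j. j < m \<Longrightarrow> P j \<le> P (Suc j)"
  shows "(\<Sum>l<P m. z l) = (\<Sum>j<m. \<Sum>l=P j..<P (Suc j). z l)"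
  using assms(2)
proof (induction m)
  case 0
  then show ?case using assms(1) by simp
next
  case (Suc m)
  have "(\<Sum>l<P (Suc m). z l) = (\<Sum>l<P m. z l) + (\<Sum>l=P m..<P (Suc m). z l)"
    using Suc.prems[of m] by (simp add: lessThan_atLeast0 sum.atLeastLessThan_concat)
  then show ?case using Suc by simp
qed

text \<open>Summing the block estimates, the variations add up to \<open>v 1 - v 0\<close>. The second term of the bound is the
  crude cost of evaluating the \<open>m\<close> frozen increments at \<open>f\<close> instead of at the nearest grid values of \<open>g\<close>.\<close>

lemma discrete_integral_block_integral:
  fixes f g :: "real \<Rightarrow> real"
  assumes av: "increments_dominated a v" and A: "\<And>s. s \<in> {0..1} \<Longrightarrow> \<bar>a s\<bar> \<le> A"
    and mN: "0 < m" "m \<le> N" and t: "t \<in> {0..1}"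
    and g: "\<And>s. s \<in> {0..1} \<Longrightarrow> \<bar>g s - f s\<bar> \<le> \<eta>"
    and \<omega>: "\<And>s s'. s \<in> {0..1} \<Longrightarrow> s' \<in> {0..1} \<Longrightarrow> \<bar>s - s'\<bar> \<le> 2 / real m \<Longrightarrow> \<bar>f s - f s'\<bar> \<le> \<omega>"
    and \<kappa>: "\<And>s s'. s \<in> {0..1} \<Longrightarrow> s' \<in> {0..1} \<Longrightarrow> \<bar>s - s'\<bar> \<le> 1 / real N \<Longrightarrow> \<bar>f s - f s'\<bar> \<le> \<kappa>"
  shows "\<bar>discrete_integral a N g t - block_integral a m f t\<bar>
      \<le> (2 * \<eta> + \<omega>) * (v 1 - v 0) + real m * (2 * A * (\<eta> + \<kappa>))"
proof -
  define P where "P j = nat \<lfloor>real N * min t (real j / real m)\<rfloor>" for j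
  define x where "x l = g (real l / real N)" for l
  define al where "al j = a (real j / real m)" for j
  have m0: "real m > 0" and N0: "real N > 0" using mN by auto
  have P0: "P 0 = 0" and Pm: "P m = nat \<lfloor>real N * t\<rfloor>" using t m0 by (simp_all add: P_def)
  have P_mono: "P j \<le> P (Suc j)" for j
    unfolding P_def using m0 N0 by (intro nat_mono floor_mono mult_left_mono) (auto simp: min_def field_simps)
  have x_near: "\<bar>x (P j) - f (min t (real j / real m))\<bar> \<le> \<eta> + \<kappa>" if "j \<le> m" for j
  proof -
    define s where "s = min t (real j / real m)"
    have s: "s \<in> {0..1}" using t by (auto simp: s_def)
    have P: "real (P j) \<le> real N * s" "real N * s < real (P j) + 1"
      using s N0 unfolding P_def s_def[symmetric] by auto
    have 1: "real (P j) / real N \<le> s" "s \<le> real (P j) / real N + 1 / real N"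
      using P N0 by (simp_all add: field_simps)
    then have in01: "real (P j) / real N \<in> {0..1}" using s by auto
    have "\<bar>f (real (P j) / real N) - f s\<bar> \<le> \<kappa>" using 1 by (intro \<kappa> in01 s) linarith
    then show ?thesis using g[OF in01] unfolding x_def s_def by linarith
  qed
  define z where "z l = a (real (Suc l) / real N) * (x (Suc l) - x l)" for l
  have "discrete_integral a N g t = (\<Sum>j<m. \<Sum>l=P j..<P (Suc j). z l)"
    using sum_grouped[of P m z, OF P0 P_mono] unfolding discrete_integral_def sum_path_def Pm z_def x_def by simp
  then have "\<bar>discrete_integral a N g t - block_integral a m f t\<bar>
      = \<bar>\<Sum>j<m. (\<Sum>l=P j..<P (Suc j). z l)
          - al (Suc j) * (f (min t (real (Suc j) / real m)) - f (min t (real j / real m)))\<bar>"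
    by (simp add: block_integral_def al_def sum_subtractf)
  also have "\<dots> \<le> (\<Sum>j<m. (2 * \<eta> + \<omega>) * (v (real (Suc j) / real m) - v (real j / real m)) + 2 * A * (\<eta> + \<kappa>))"
  proof (rule order.trans[OF sum_abs sum_mono])
    fix j assume "j \<in> {..<m}"
    then have j: "j < m" by simp
    have A_j: "\<bar>al (Suc j)\<bar> \<le> A" unfolding al_def using j by (intro A) auto
    have "\<bar>(\<Sum>l=P j..<P (Suc j). z l) - al (Suc j) * (x (P (Suc j)) - x (P j))\<bar>
        \<le> (2 * \<eta> + \<omega>) * (v (real (Suc j) / real m) - v (real j / real m))"
      using block_estimate[OF av mN t j g \<omega>] unfolding P_def x_def z_def al_def by simp
    moreover have "\<bar>al (Suc j) * ((x (P (Suc j)) - x (P j))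
        - (f (min t (real (Suc j) / real m)) - f (min t (real j / real m))))\<bar> \<le> A * (2 * (\<eta> + \<kappa>))"
      unfolding abs_mult using A_j x_near[of j] x_near[of "Suc j"] j by (intro mult_mono) auto
    ultimately show "\<bar>(\<Sum>l=P j..<P (Suc j). z l)
        - al (Suc j) * (f (min t (real (Suc j) / real m)) - f (min t (real j / real m)))\<bar>
        \<le> (2 * \<eta> + \<omega>) * (v (real (Suc j) / real m) - v (real j / real m)) + 2 * A * (\<eta> + \<kappa>)"
      by (simp only: right_diff_distrib)
  qed
  also have "\<dots> = (2 * \<eta> + \<omega>) * (v (real m / real m) - v (real 0 / real m)) + real m * (2 * A * (\<eta> + \<kappa>))"
    using sum_lessThan_telescope[of "\<lambda>j. v (real j / real m)" m]
    by (simp add: sum.distrib sum_distrib_left[symmetric])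
  finally show ?thesis using m0 by simp
qed

text \<open>The order of the choices matters: \<open>m\<close> is fixed first, from the modulus of continuity of \<open>f\<close>; only
  then are the error in \<open>g\<close> and the mesh \<open>1/n\<close> made small against \<open>1/m\<close>. As the block integral depends on
  neither \<open>n\<close> nor \<open>g\<close>, this is a Cauchy property of the discrete integrals.\<close>

lemma discrete_integral_near_continuous:
  assumes av: "increments_dominated a v" and f: "continuous_on {0..1} f" and "\<epsilon> > 0"
  obtains m \<delta> K where "\<delta> > 0"
    "\<And>n g t. n \<ge> K \<Longrightarrow> (\<And>s. s \<in> {0..1} \<Longrightarrow> \<bar>g s - f s\<bar> \<le> \<delta>) \<Longrightarrow> t \<in> {0..1} \<Longrightarrow>
       \<bar>discrete_integral a n g t - block_integral a m f t\<bar> \<le> \<epsilon>"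
proof -
  define V where "V = v 1 - v 0 + 1"
  define A where "A = \<bar>a 0\<bar> + V"
  have V: "V > 0" using increments_dominated_mono[OF av, of 0 1] by (simp add: V_def)
  then have A0: "A > 0" by (simp add: A_def)
  have A: "\<bar>a s\<bar> \<le> A" if "s \<in> {0..1}" for s
    using increments_dominated_bound[OF av that] by (simp add: A_def V_def)
  have "uniformly_continuous_on {0..1} f"
    using f by (intro compact_uniformly_continuous) auto
  then have modulus: "\<exists>d>0. \<forall>s\<in>{0..1}. \<forall>s'\<in>{0..1}. \<bar>s - s'\<bar> < d \<longrightarrow> \<bar>f s - f s'\<bar> \<le> r" if "r > 0" for r
    using that unfolding uniformly_continuous_on_def dist_real_def
    by (metis abs_minus_commute order.strict_implies_order)
  define \<omega> where "\<omega> = \<epsilon> / (4 * V)"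
  have \<omega>: "\<omega> > 0" using \<open>\<epsilon> > 0\<close> V by (simp add: \<omega>_def)
  obtain d where d: "d > 0"
      "\<And>s s'. s \<in> {0..1} \<Longrightarrow> s' \<in> {0..1} \<Longrightarrow> \<bar>s - s'\<bar> < d \<Longrightarrow> \<bar>f s - f s'\<bar> \<le> \<omega>"
    using modulus[OF \<omega>] by blast
  obtain m :: nat where m: "2 / d < real m" using reals_Archimedean2 by blast
  have m0: "real m > 0" using m d(1) by (metis divide_pos_pos less_trans zero_less_numeral)
  define \<kappa> where "\<kappa> = min (\<epsilon> / (8 * (real m * A))) (\<epsilon> / (8 * V))"
  have mA: "real m * A > 0" using m0 A0 by simp
  have \<kappa>: "\<kappa> > 0" using \<open>\<epsilon> > 0\<close> V mA unfolding \<kappa>_def by simp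
  obtain d' where d': "d' > 0"
      "\<And>s s'. s \<in> {0..1} \<Longrightarrow> s' \<in> {0..1} \<Longrightarrow> \<bar>s - s'\<bar> < d' \<Longrightarrow> \<bar>f s - f s'\<bar> \<le> \<kappa>"
    using modulus[OF \<kappa>] by blast
  obtain k :: nat where k: "1 / d' < real k" using reals_Archimedean2 by blast
  have "\<bar>discrete_integral a n g t - block_integral a m f t\<bar> \<le> \<epsilon>"
    if n: "n \<ge> max m k" and g: "\<And>s. s \<in> {0..1} \<Longrightarrow> \<bar>g s - f s\<bar> \<le> \<kappa>" and t: "t \<in> {0..1}" for n g t
  proof -
    have n0: "real n > 0" using n m0 by simp
    have "2 / real m < d" using m m0 d(1) by (simp add: field_simps)
    moreover have "1 / d' < real n" using k n by (meson less_le_trans max.boundedE of_nat_le_iff)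
    then have "1 / real n < d'" using n0 d'(1) by (simp add: field_simps)
    ultimately have "\<bar>discrete_integral a n g t - block_integral a m f t\<bar>
        \<le> (2 * \<kappa> + \<omega>) * (v 1 - v 0) + real m * (2 * A * (\<kappa> + \<kappa>))"
      using n m0 by (intro discrete_integral_block_integral[OF av A _ _ t g] d(2) d'(2)) auto
    also have "\<dots> \<le> (2 * \<kappa> + \<omega>) * V + 4 * (\<kappa> * (real m * A))"
      using \<kappa> \<omega> by (simp add: V_def algebra_simps)
    also have "\<dots> \<le> \<epsilon>"
    proof -
      have "\<kappa> * (real m * A) \<le> \<epsilon> / 8"
        using mA unfolding pos_le_divide_eq[OF mA, symmetric] by (simp add: \<kappa>_def)
      moreover have "\<kappa> * V \<le> \<epsilon> / 8"
        using V unfolding pos_le_divide_eq[OF V, symmetric] by (simp add: \<kappa>_def)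
      moreover have "\<omega> * V = \<epsilon> / 4" using V by (simp add: \<omega>_def)
      ultimately show ?thesis by (simp add: distrib_right)
    qed
    finally show ?thesis .
  qed
  then show thesis using that[OF \<kappa>, of "max m k" m] by blast
qed

section \<open>The variance clock\<close>

text \<open>Such a function is the difference of the two monotone functions \<open>w\<close> and \<open>w - g\<close>.\<close>

lemma increments_dominated_integrable:
  assumes "increments_dominated g w"
  shows "g integrable_on {0..1}"
proof -
  have "mono_on {0..1} w"
    using increments_dominated_mono[OF assms] by (intro mono_onI) auto
  moreover have "mono_on {0..1} (\<lambda>x. w x - g x)"
  proof (intro mono_onI)
    fix r s :: real assume "r \<in> {0..1}" "s \<in> {0..1}" "r \<le> s"
    then have "\<bar>g s - g r\<bar> \<le> w s - w r" by (intro increments_dominatedD[OF assms]) auto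
    then show "w r - g r \<le> w s - g s" by linarith
  qed
  ultimately have "(\<lambda>x. w x - (w x - g x)) integrable_on {0..1}"
    by (intro integrable_diff integrable_on_mono_on)
  then show ?thesis by simp
qed

lemma increments_dominated_square:
  assumes "increments_dominated a v" and A: "\<And>s. s \<in> {0..1} \<Longrightarrow> \<bar>a s\<bar> \<le> A"
  shows "increments_dominated (\<lambda>s. (a s)\<^sup>2) (\<lambda>s. 2 * A * v s)"
  unfolding increments_dominated_def
proof (intro allI impI)
  fix x y :: real assume xy: "0 \<le> x" "x \<le> y" "y \<le> 1"
  have "(a y)\<^sup>2 - (a x)\<^sup>2 = (a y + a x) * (a y - a x)" by (simp add: power2_eq_square algebra_simps)
  moreover have "\<bar>(a y + a x) * (a y - a x)\<bar> \<le> (2 * A) * (v y - v x)"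
    unfolding abs_mult using increments_dominatedD[OF assms(1) xy] A[of x] A[of y] xy
    by (intro mult_mono) auto
  ultimately show "\<bar>(a y)\<^sup>2 - (a x)\<^sup>2\<bar> \<le> 2 * A * v y - 2 * A * v x"
    by (simp add: right_diff_distrib)
qed

lemma abs_integral_le:
  fixes f :: "real \<Rightarrow> real"
  assumes "f integrable_on {x..y}" "x \<le> y" "\<And>s. s \<in> {x..y} \<Longrightarrow> \<bar>f s\<bar> \<le> B"
  shows "\<bar>integral {x..y} f\<bar> \<le> B * (y - x)"
proof -
  have "norm (integral {x..y} f) \<le> integral {x..y} (\<lambda>_. B)"
    using assms by (intro integral_norm_bound_integral) auto
  then show ?thesis using \<open>x \<le> y\<close> by (simp add: mult.commute)
qed

lemma riemann_sum_error:
  assumes g: "increments_dominated g w" and m: "m > 0" and "k \<le> m"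
  shows "\<bar>integral {0..real k / real m} g - (\<Sum>j<k. g (real (Suc j) / real m)) / real m\<bar>
    \<le> (w (real k / real m) - w 0) / real m"
  using \<open>k \<le> m\<close>
proof (induction k)
  case 0
  then show ?case by simp
next
  case (Suc k)
  define x y where "x = real k / real m" and "y = real (Suc k) / real m"
  have m0: "real m > 0" using m by simp
  have xy: "0 \<le> x" "x \<le> y" "y \<le> 1" "y - x = 1 / real m"
    using Suc.prems m0 unfolding x_def y_def by (auto simp: field_simps)
  have int: "g integrable_on {0..y}"
    using integrable_on_subinterval[OF increments_dominated_integrable[OF g]] xy by simp
  then have int': "g integrable_on {x..y}"
    by (rule integrable_on_subinterval) (use xy in auto)
  have "integral {0..x} g + integral {x..y} g = integral {0..y} g"
    by (rule Henstock_Kurzweil_Integration.integral_combine) (use xy int in auto)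
  moreover have "\<bar>integral {x..y} g - g y / real m\<bar> \<le> (w y - w x) / real m"
  proof -
    have "\<bar>integral {x..y} (\<lambda>s. g s - g y)\<bar> \<le> (w y - w x) * (y - x)"
    proof (rule abs_integral_le)
      fix s assume s: "s \<in> {x..y}"
      then have "\<bar>g y - g s\<bar> \<le> w y - w s" "w x \<le> w s"
        using xy increments_dominatedD[OF g, of s y] increments_dominated_mono[OF g, of x s] by auto
      then show "\<bar>g s - g y\<bar> \<le> w y - w x" by linarith
    qed (use xy int' in \<open>auto intro!: integrable_diff\<close>)
    moreover have "integral {x..y} (\<lambda>s. g s - g y) = integral {x..y} g - g y * (y - x)"
      using int' xy by (subst Henstock_Kurzweil_Integration.integral_diff) (auto simp: mult.commute)
    ultimately show ?thesis using xy(4) by simp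
  qed
  moreover have "\<bar>integral {0..x} g - (\<Sum>j<k. g (real (Suc j) / real m)) / real m\<bar> \<le> (w x - w 0) / real m"
    using Suc unfolding x_def by simp
  moreover have "(\<Sum>j<Suc k. g (real (Suc j) / real m)) / real m
      = (\<Sum>j<k. g (real (Suc j) / real m)) / real m + g y / real m"
    by (simp add: y_def add_divide_distrib)
  moreover have "(w y - w 0) / real m = (w y - w x) / real m + (w x - w 0) / real m"
    by (simp add: diff_divide_distrib)
  ultimately show ?case
    unfolding y_def[symmetric] by linarith
qed

text \<open>A zero value of \<open>a\<close> would give a degenerate normal law on one side of the comparison below and a repeated
  time of observation on the other. Replacing it by \<open>1/m\<close> changes neither the limit of the clocks nor, for a
  continuous integrator, that of the integrals.\<close>

definition nonzero_weight :: "(real \<Rightarrow> real) \<Rightarrow> nat \<Rightarrow> nat \<Rightarrow> real" where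
  "nonzero_weight a m j =
     (if a (real (Suc j) / real m) = 0 then 1 / real m else a (real (Suc j) / real m))"

text \<open>The variance that the sum of the first \<open>k\<close> weighted Wiener increments accumulates.\<close>

definition discrete_clock :: "(real \<Rightarrow> real) \<Rightarrow> real \<Rightarrow> nat \<Rightarrow> nat \<Rightarrow> real" where
  "discrete_clock a \<sigma> m k = \<sigma>\<^sup>2 * ((\<Sum>j<k. (nonzero_weight a m j)\<^sup>2) / real m)"

lemma nonzero_weight_neq_0: "m > 0 \<Longrightarrow> nonzero_weight a m j \<noteq> 0"
  by (simp add: nonzero_weight_def)

lemma nonzero_weight_near: "\<bar>nonzero_weight a m j - a (real (Suc j) / real m)\<bar> \<le> 1 / real m"
  by (simp add: nonzero_weight_def)

lemma discrete_clock_nonneg: "0 \<le> discrete_clock a \<sigma> m k"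
  by (simp add: discrete_clock_def sum_nonneg)

lemma discrete_clock_increment:
  "discrete_clock a \<sigma> m (Suc k) - discrete_clock a \<sigma> m k = (\<sigma> * nonzero_weight a m k)\<^sup>2 / real m"
  by (simp add: discrete_clock_def add_divide_distrib distrib_left power_mult_distrib)

lemma strict_mono_discrete_clock:
  assumes "\<sigma> \<noteq> 0" "m > 0"
  shows "strict_mono (discrete_clock a \<sigma> m)"
  unfolding strict_mono_Suc_iff
proof
  fix k
  have "0 < (\<sigma> * nonzero_weight a m k)\<^sup>2 / real m"
    using assms nonzero_weight_neq_0[OF assms(2)] by simp
  then show "discrete_clock a \<sigma> m k < discrete_clock a \<sigma> m (Suc k)"
    using discrete_clock_increment[of a \<sigma> m k] by linarith
qed

text \<open>Three errors of order \<open>1/m\<close>: the replaced zero weights, the Riemann sum for \<open>a\<^sup>2\<close> up to the last grid point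
  before \<open>t\<close>, and the integral from there to \<open>t\<close>.\<close>

lemma discrete_clock_near:
  assumes av: "increments_dominated a v"
  obtains C where "\<And>m t. m > 0 \<Longrightarrow> t \<in> {0..1} \<Longrightarrow>
    \<bar>discrete_clock a \<sigma> m (nat \<lfloor>real m * t\<rfloor>) - \<sigma>\<^sup>2 * integral {0..t} (\<lambda>s. (a s)\<^sup>2)\<bar> \<le> C / real m"
proof -
  define A where "A = \<bar>a 0\<bar> + (v 1 - v 0)"
  have A: "\<bar>a s\<bar> \<le> A" if "s \<in> {0..1}" for s
    using increments_dominated_bound[OF av that] by (simp add: A_def)
  define g w where "g s = (a s)\<^sup>2" and "w s = 2 * A * v s" for s
  have gw: "increments_dominated g w"
    unfolding g_def w_def by (rule increments_dominated_square[OF av A])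
  have int: "g integrable_on {0..1}" by (rule increments_dominated_integrable[OF gw])
  have "\<bar>(\<Sum>j<nat \<lfloor>real m * t\<rfloor>. (nonzero_weight a m j)\<^sup>2) / real m - integral {0..t} g\<bar>
      \<le> (1 + (w 1 - w 0) + A\<^sup>2) / real m" if m: "m > 0" and t: "t \<in> {0..1}" for m t
  proof -
    define k where "k = nat \<lfloor>real m * t\<rfloor>"
    define s where "s = real k / real m"
    have m0: "real m > 0" using m by simp
    have km: "k \<le> m" unfolding k_def by (rule floor_le_grid[OF t])
    have k: "real k \<le> real m * t" "real m * t \<le> real k + 1" using t unfolding k_def by auto
    then have "t \<le> (real k + 1) / real m" "s \<le> t"
      using m0 unfolding s_def by (simp_all add: pos_le_divide_eq pos_divide_le_eq mult.commute)
    then have s: "0 \<le> s" "s \<le> t" "t - s \<le> 1 / real m" "s \<le> 1"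
      using t unfolding s_def by (simp_all add: add_divide_distrib)
    have "\<bar>(\<Sum>j<k. (nonzero_weight a m j)\<^sup>2) - (\<Sum>j<k. g (real (Suc j) / real m))\<bar> \<le> (\<Sum>j<k. 1 / real m)"
      unfolding sum_subtractf[symmetric]
    proof (rule order.trans[OF sum_abs sum_mono])
      fix j
      have "(1 / real m)\<^sup>2 \<le> 1 / real m"
        using m by (simp add: power2_eq_square field_simps)
      then show "\<bar>(nonzero_weight a m j)\<^sup>2 - g (real (Suc j) / real m)\<bar> \<le> 1 / real m"
        by (simp add: nonzero_weight_def g_def)
    qed
    also have "\<dots> \<le> 1" using km m0 by simp
    finally have "\<bar>(\<Sum>j<k. (nonzero_weight a m j)\<^sup>2) / real m - (\<Sum>j<k. g (real (Suc j) / real m)) / real m\<bar> \<le> 1 / real m"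
      using m0 unfolding diff_divide_distrib[symmetric] abs_divide by (simp add: divide_right_mono)
    moreover have "\<bar>integral {0..s} g - (\<Sum>j<k. g (real (Suc j) / real m)) / real m\<bar> \<le> (w s - w 0) / real m"
      unfolding s_def by (rule riemann_sum_error[OF gw m km])
    moreover have "(w s - w 0) / real m \<le> (w 1 - w 0) / real m"
      using increments_dominated_mono[OF gw, of s 1] s m0 by (simp add: divide_right_mono)
    moreover have "\<bar>integral {0..t} g - integral {0..s} g\<bar> \<le> A\<^sup>2 / real m"
    proof -
      have "integral {0..s} g + integral {s..t} g = integral {0..t} g"
        using s t by (intro Henstock_Kurzweil_Integration.integral_combine
            integrable_on_subinterval[OF int]) auto
      moreover have "\<bar>integral {s..t} g\<bar> \<le> A\<^sup>2 * (t - s)"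
      proof (rule abs_integral_le)
        show "g integrable_on {s..t}" using s t by (intro integrable_on_subinterval[OF int]) auto
        fix r assume "r \<in> {s..t}"
        then have "\<bar>a r\<bar> \<le> A" using s t by (intro A) auto
        then have "\<bar>a r\<bar>\<^sup>2 \<le> A\<^sup>2" by (intro power_mono) auto
        then show "\<bar>g r\<bar> \<le> A\<^sup>2" by (simp add: g_def)
      qed (use s in auto)
      moreover have "A\<^sup>2 * (t - s) \<le> A\<^sup>2 * (1 / real m)" using s by (intro mult_left_mono) auto
      ultimately show ?thesis by simp
    qed
    ultimately show ?thesis
      unfolding k_def[symmetric] add_divide_distrib by linarith
  qed
  then have "\<sigma>\<^sup>2 * \<bar>(\<Sum>j<nat \<lfloor>real m * t\<rfloor>. (nonzero_weight a m j)\<^sup>2) / real m - integral {0..t} g\<bar>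
      \<le> \<sigma>\<^sup>2 * ((1 + (w 1 - w 0) + A\<^sup>2) / real m)" if "m > 0" "t \<in> {0..1}" for m t
    using that by (intro mult_left_mono) auto
  moreover have "\<sigma>\<^sup>2 * \<bar>x / r - y\<bar> = \<bar>\<sigma>\<^sup>2 * (x / r) - \<sigma>\<^sup>2 * y\<bar>" for x y r :: real
    unfolding right_diff_distrib[symmetric] abs_mult by simp
  ultimately show thesis
    using that[of "\<sigma>\<^sup>2 * (1 + (w 1 - w 0) + A\<^sup>2)"] unfolding discrete_clock_def g_def by simp
qed

section \<open>Gaussian increments\<close>

text \<open>By independence the law of the vector is a product measure, hence determined by the marginal
  laws. The function \<open>K\<close> is defined on all sequences but looks at the first \<open>m\<close> entries only.\<close>

lemma (in prob_space) indep_vars_expectation: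
  fixes X :: "nat \<Rightarrow> 'a \<Rightarrow> real" and K :: "(nat \<Rightarrow> real) \<Rightarrow> real"
  assumes m: "m > 0" and X: "indep_vars (\<lambda>_. borel) X {..<m}"
    and K: "K \<in> borel_measurable borel"
    and K_cong: "\<And>x y. (\<And>j. j < m \<Longrightarrow> x j = y j) \<Longrightarrow> K x = K y"
  shows "expectation (\<lambda>\<omega>. K (\<lambda>j. X j \<omega>)) = (\<integral>x. K x \<partial>(\<Pi>\<^sub>M j\<in>{..<m}. distr M borel (X j)))"
proof -
  let ?P = "\<Pi>\<^sub>M j\<in>{..<m}. (borel :: real measure)"
  have "(\<lambda>x::nat \<Rightarrow> real. x j) \<in> borel_measurable ?P" for j
  proof (cases "j < m")
    case True
    then show ?thesis by (intro measurable_component_singleton) simp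
  next
    case False
    then have "(\<lambda>x::nat \<Rightarrow> real. x j) \<in> borel_measurable ?P \<longleftrightarrow> (\<lambda>x::nat \<Rightarrow> real. undefined :: real) \<in> borel_measurable ?P"
      by (intro measurable_cong) (auto simp: space_PiM PiE_def extensional_def)
    then show ?thesis by simp
  qed
  then have "(\<lambda>x. x) \<in> ?P \<rightarrow>\<^sub>M borel" by (rule measurable_coordinatewise_then_product)
  then have K_P: "K \<in> borel_measurable ?P" using K by (rule measurable_compose)
  have rv: "random_variable borel (X j)" if "j \<in> {..<m}" for j
    using X that unfolding indep_vars_def by auto
  have "distr M ?P (\<lambda>\<omega>. \<lambda>j\<in>{..<m}. X j \<omega>) = (\<Pi>\<^sub>M j\<in>{..<m}. distr M borel (X j))"
    using indep_vars_iff_distr_eq_PiM'[of "{..<m}" X "\<lambda>_. borel"] rv X m by auto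
  moreover have "(\<integral>x. K x \<partial>distr M ?P (\<lambda>\<omega>. \<lambda>j\<in>{..<m}. X j \<omega>)) = expectation (\<lambda>\<omega>. K (\<lambda>j\<in>{..<m}. X j \<omega>))"
    using rv K_P by (intro integral_distr measurable_restrict) auto
  moreover have "K (\<lambda>j\<in>{..<m}. X j \<omega>) = K (\<lambda>j. X j \<omega>)" for \<omega> by (rule K_cong) simp
  ultimately show ?thesis by simp
qed

lemma indep_vars_expectation_eq:
  fixes X :: "nat \<Rightarrow> 'a \<Rightarrow> real" and X' :: "nat \<Rightarrow> 'b \<Rightarrow> real" and K :: "(nat \<Rightarrow> real) \<Rightarrow> real"
  assumes "prob_space M" "prob_space M'" and m: "m > 0"
    and X: "prob_space.indep_vars M (\<lambda>_. borel) X {..<m}"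
    and X': "prob_space.indep_vars M' (\<lambda>_. borel) X' {..<m}"
    and distr: "\<And>j. j < m \<Longrightarrow> distr M borel (X j) = distr M' borel (X' j)"
    and K: "K \<in> borel_measurable borel"
    and K_cong: "\<And>x y. (\<And>j. j < m \<Longrightarrow> x j = y j) \<Longrightarrow> K x = K y"
  shows "(\<integral>\<omega>. K (\<lambda>j. X j \<omega>) \<partial>M) = (\<integral>\<omega>. K (\<lambda>j. X' j \<omega>) \<partial>M')"
proof -
  have "(\<Pi>\<^sub>M j\<in>{..<m}. distr M borel (X j)) = (\<Pi>\<^sub>M j\<in>{..<m}. distr M' borel (X' j))"
    using distr by (intro PiM_cong) auto
  then show ?thesis
    using prob_space.indep_vars_expectation[OF assms(1) m X K K_cong]
      prob_space.indep_vars_expectation[OF assms(2) m X' K K_cong] by simp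
qed

lemma wiener_process_increment_distributed:
  assumes "wiener_process_on T M W" "s \<in> T" "t \<in> T" "s < t"
  shows "distributed M lborel (\<lambda>\<omega>. W t \<omega> - W s \<omega>) (normal_density 0 (sqrt (t - s)))"
  using assms unfolding wiener_process_on_def by blast

lemma wiener_process_increments_indep:
  fixes \<tau> :: "nat \<Rightarrow> real"
  assumes "wiener_process_on T M W" "strict_mono_on {..n} \<tau>" "\<tau> ` {..n} \<subseteq> T"
  shows "prob_space.indep_vars M (\<lambda>_. borel) (\<lambda>i \<omega>. W (\<tau> (Suc i)) \<omega> - W (\<tau> i) \<omega>) {..<n}"
  using assms unfolding wiener_process_on_def by blast

text \<open>Brownian scaling at a finite set of times: both families of increments are independent and normal with
  mean zero and variances \<open>(\<sigma> nonzero_weight a m j)\<^sup>2 / m\<close>. The clock is strictly increasing, so its values are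
  admissible times of observation of \<open>W\<close>.\<close>

lemma expectation_weighted_increments_eq_time_changed:
  assumes W\<^sub>0: "wiener_process_on {0..1} M\<^sub>0 W\<^sub>0" and W: "wiener_process_on {0..} M\<^sub>1 W"
    and "\<sigma> \<noteq> 0" and m: "m > 0" and K: "K \<in> borel_measurable borel"
    and K_cong: "\<And>x y. (\<And>j. j < m \<Longrightarrow> x j = y j) \<Longrightarrow> K x = (K y :: real)"
  shows "(\<integral>\<omega>. K (\<lambda>j. \<sigma> * nonzero_weight a m j * (W\<^sub>0 (real (Suc j) / real m) \<omega> - W\<^sub>0 (real j / real m) \<omega>)) \<partial>M\<^sub>0)
    = (\<integral>\<omega>. K (\<lambda>j. W (discrete_clock a \<sigma> m (Suc j)) \<omega> - W (discrete_clock a \<sigma> m j) \<omega>) \<partial>M\<^sub>1)"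
proof -
  have P0: "prob_space M\<^sub>0" and P1: "prob_space M\<^sub>1"
    using W\<^sub>0 W by (simp_all add: wiener_process_on_def)
  interpret M0: prob_space M\<^sub>0 by fact
  let ?c = "\<lambda>j. \<sigma> * nonzero_weight a m j"
  have m0: "real m > 0" using m by simp
  show ?thesis
  proof (rule indep_vars_expectation_eq[OF P0 P1 m _ _ _ K K_cong])
    have "M0.indep_vars (\<lambda>_. borel) (\<lambda>j \<omega>. W\<^sub>0 (real (Suc j) / real m) \<omega> - W\<^sub>0 (real j / real m) \<omega>) {..<m}"
      by (rule wiener_process_increments_indep[OF W\<^sub>0])
        (use m0 in \<open>auto simp: strict_mono_on_def field_simps\<close>)
    then show "M0.indep_vars (\<lambda>_. borel)
        (\<lambda>j \<omega>. ?c j * (W\<^sub>0 (real (Suc j) / real m) \<omega> - W\<^sub>0 (real j / real m) \<omega>)) {..<m}"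
      by (rule M0.indep_vars_compose2[where Y = "\<lambda>j x. ?c j * x"]) simp
    show "prob_space.indep_vars M\<^sub>1 (\<lambda>_. borel)
        (\<lambda>j \<omega>. W (discrete_clock a \<sigma> m (Suc j)) \<omega> - W (discrete_clock a \<sigma> m j) \<omega>) {..<m}"
      by (rule wiener_process_increments_indep[OF W])
        (use strict_mono_discrete_clock[OF \<open>\<sigma> \<noteq> 0\<close> m] discrete_clock_nonneg in
          \<open>auto simp: strict_mono_on_def strict_mono_def\<close>)
    fix j assume j: "j < m"
    have c: "?c j \<noteq> 0" using \<open>\<sigma> \<noteq> 0\<close> nonzero_weight_neq_0[OF m] by simp
    have "distributed M\<^sub>0 lborel (\<lambda>\<omega>. W\<^sub>0 (real (Suc j) / real m) \<omega> - W\<^sub>0 (real j / real m) \<omega>)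
        (normal_density 0 (sqrt (real (Suc j) / real m - real j / real m)))"
      by (rule wiener_process_increment_distributed[OF W\<^sub>0]) (use j m0 in \<open>auto simp: field_simps\<close>)
    moreover have "real (Suc j) / real m - real j / real m = 1 / real m"
      by (simp add: diff_divide_distrib[symmetric])
    ultimately have "distributed M\<^sub>0 lborel
        (\<lambda>\<omega>. 0 + ?c j * (W\<^sub>0 (real (Suc j) / real m) \<omega> - W\<^sub>0 (real j / real m) \<omega>))
        (normal_density (0 + ?c j * 0) (\<bar>?c j\<bar> * sqrt (1 / real m)))"
      using c m0 by (intro M0.normal_density_affine) auto
    moreover have "\<bar>?c j\<bar> * sqrt (1 / real m) = sqrt (discrete_clock a \<sigma> m (Suc j) - discrete_clock a \<sigma> m j)"
      unfolding discrete_clock_increment by (simp add: real_sqrt_divide)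
    moreover have "distributed M\<^sub>1 lborel
        (\<lambda>\<omega>. W (discrete_clock a \<sigma> m (Suc j)) \<omega> - W (discrete_clock a \<sigma> m j) \<omega>)
        (normal_density 0 (sqrt (discrete_clock a \<sigma> m (Suc j) - discrete_clock a \<sigma> m j)))"
      using strict_mono_discrete_clock[OF \<open>\<sigma> \<noteq> 0\<close> m] discrete_clock_nonneg
      by (intro wiener_process_increment_distributed[OF W]) (auto simp: strict_mono_def)
    ultimately have "distr M\<^sub>0 lborel (\<lambda>\<omega>. ?c j * (W\<^sub>0 (real (Suc j) / real m) \<omega> - W\<^sub>0 (real j / real m) \<omega>))
        = distr M\<^sub>1 lborel (\<lambda>\<omega>. W (discrete_clock a \<sigma> m (Suc j)) \<omega> - W (discrete_clock a \<sigma> m j) \<omega>)"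
      by (simp add: distributed_distr_eq_density)
    moreover have "distr M\<^sub>0 borel Z = distr M\<^sub>0 lborel Z" "distr M\<^sub>1 borel Z' = distr M\<^sub>1 lborel Z'"
      for Z Z' :: "_ \<Rightarrow> real" by (intro distr_cong refl; simp)+
    ultimately show "distr M\<^sub>0 borel (\<lambda>\<omega>. ?c j * (W\<^sub>0 (real (Suc j) / real m) \<omega> - W\<^sub>0 (real j / real m) \<omega>))
        = distr M\<^sub>1 borel (\<lambda>\<omega>. W (discrete_clock a \<sigma> m (Suc j)) \<omega> - W (discrete_clock a \<sigma> m j) \<omega>)"
      by simp
  qed
qed

section \<open>Convergence of the transformed processes\<close>

text \<open>The discrete integral multiplies each jump of a path on the same grid by the value of \<open>a\<close> there.\<close>

lemma discrete_integral_sum_path: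
  "to_D01 (discrete_integral a N (apply_skorokhod01 (to_D01 (sum_path N x))))
    = to_D01 (sum_path N (\<lambda>l. a (real (Suc l) / real N) * x l))"
proof (rule to_D01_cong)
  fix t :: real assume t: "t \<in> {0..1}"
  have "apply_skorokhod01 (to_D01 (sum_path N x)) (real (Suc l) / real N)
      - apply_skorokhod01 (to_D01 (sum_path N x)) (real l / real N) = x l" if "l < nat \<lfloor>real N * t\<rfloor>" for l
  proof -
    have "l < N" using that floor_le_grid[OF t, of N] by simp
    then have "N > 0" "real (Suc l) / real N \<in> {0..1}" "real l / real N \<in> {0..1}" by auto
    then show ?thesis
      by (simp only: apply_to_D01[OF cadlag_sum_path] sum_path_at_grid) simp
  qed
  then show "discrete_integral a N (apply_skorokhod01 (to_D01 (sum_path N x))) t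
      = sum_path N (\<lambda>l. a (real (Suc l) / real N) * x l) t"
    unfolding discrete_integral_def sum_path_def[of _ _ t] by (intro sum.cong) auto
qed

text \<open>The limit is taken in the reals, after applying \<open>F\<close>; the Lipschitz property of \<open>F\<close> turns the uniform
  Cauchy property of the discrete integrals into one of real numbers, locally uniform around the continuous path \<open>s\<close>.\<close>

lemma lipschitz_functional_converges:
  fixes F :: "skorokhod01 \<Rightarrow> real"
  assumes av: "increments_dominated a v" and F: "\<And>x y. \<bar>F x - F y\<bar> \<le> L * dist x y"
    and f: "continuous_on {0..1} (apply_skorokhod01 s)" and "\<epsilon> > 0"
  defines "G \<equiv> \<lambda>n x. F (to_D01 (discrete_integral a n (apply_skorokhod01 x)))"
  shows "(\<lambda>n. G n s) \<longlonglongrightarrow> lim (\<lambda>n. G n s)"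
    and "\<exists>\<delta>>0. \<exists>K. \<forall>n\<ge>K. \<forall>x. dist x s < \<delta> \<longrightarrow> \<bar>G n x - lim (\<lambda>n. G n s)\<bar> \<le> \<epsilon>"
proof -
  have cauchy: "\<exists>\<delta>>0. \<exists>K. \<forall>n\<ge>K. \<forall>n'\<ge>K. \<forall>x x'. dist x s < \<delta> \<longrightarrow> dist x' s < \<delta> \<longrightarrow> \<bar>G n x - G n' x'\<bar> \<le> r"
    if r: "r > 0" for r
  proof -
    define c where "c = \<bar>L\<bar> + 1"
    have c: "c > 0" "L \<le> c" by (auto simp: c_def)
    define \<rho> where "\<rho> = r / (2 * c)"
    have \<rho>: "\<rho> > 0" using r c by (simp add: \<rho>_def)
    obtain m \<eta> K where \<eta>: "\<eta> > 0"
      and K: "\<And>n g t. n \<ge> K \<Longrightarrow> (\<And>s'. s' \<in> {0..1} \<Longrightarrow> \<bar>g s' - apply_skorokhod01 s s'\<bar> \<le> \<eta>) \<Longrightarrow> t \<in> {0..1} \<Longrightarrow>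
        \<bar>discrete_integral a n g t - block_integral a m (apply_skorokhod01 s) t\<bar> \<le> \<rho>"
      using discrete_integral_near_continuous[OF av f \<rho>] by metis
    obtain \<delta> where \<delta>: "\<delta> > 0"
      "\<And>x t. dist x s < \<delta> \<Longrightarrow> t \<in> {0..1} \<Longrightarrow> \<bar>apply_skorokhod01 x t - apply_skorokhod01 s t\<bar> \<le> \<eta>"
      using uniformly_close_if_dist_small[OF f \<eta>] by metis
    have "\<bar>G n x - G n' x'\<bar> \<le> r" if n: "n \<ge> K" "n' \<ge> K" and x: "dist x s < \<delta>" "dist x' s < \<delta>" for n n' x x'
    proof -
      let ?I = "\<lambda>n x. discrete_integral a n (apply_skorokhod01 x)"
      have "dist (to_D01 (?I n x)) (to_D01 (?I n' x')) \<le> 2 * \<rho>"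
      proof (rule dist_to_D01_le)
        fix t :: real assume t: "t \<in> {0..1}"
        show "\<bar>?I n x t - ?I n' x' t\<bar> \<le> 2 * \<rho>"
          using K[OF n(1) \<delta>(2)[OF x(1)] t] K[OF n(2) \<delta>(2)[OF x(2)] t] by linarith
      qed (simp_all add: discrete_integral_def cadlag_sum_path)
      then have "L * dist (to_D01 (?I n x)) (to_D01 (?I n' x')) \<le> c * (2 * \<rho>)"
        using c by (intro mult_mono) auto
      also have "\<dots> = r" using c by (simp add: \<rho>_def)
      finally show ?thesis unfolding G_def using F order.trans by blast
    qed
    then show ?thesis using \<delta>(1) by blast
  qed
  have "Cauchy (\<lambda>n. G n s)"
  proof (rule metric_CauchyI)
    fix r :: real assume "r > 0"
    then obtain \<delta> K where "\<delta> > 0" "\<forall>n\<ge>K. \<forall>n'\<ge>K. \<forall>x x'. dist x s < \<delta> \<longrightarrow> dist x' s < \<delta> \<longrightarrow> \<bar>G n x - G n' x'\<bar> \<le> r / 2"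
      using cauchy[of "r / 2"] by auto
    then have "dist (G n s) (G n' s) < r" if "n \<ge> K" "n' \<ge> K" for n n'
      using that \<open>r > 0\<close> unfolding dist_real_def by (metis dist_self field_sum_of_halves less_add_same_cancel1 half_gt_zero order.strict_trans1)
    then show "\<exists>K. \<forall>n\<ge>K. \<forall>n'\<ge>K. dist (G n s) (G n' s) < r" by blast
  qed
  then show lim: "(\<lambda>n. G n s) \<longlonglongrightarrow> lim (\<lambda>n. G n s)"
    by (simp add: Cauchy_convergent_iff convergent_LIMSEQ_iff)
  obtain \<delta> K where \<delta>: "\<delta> > 0"
    and K: "\<And>n n' x x'. n \<ge> K \<Longrightarrow> n' \<ge> K \<Longrightarrow> dist x s < \<delta> \<Longrightarrow> dist x' s < \<delta> \<Longrightarrow> \<bar>G n x - G n' x'\<bar> \<le> \<epsilon>"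
    using cauchy[OF \<open>\<epsilon> > 0\<close>] by metis
  have "\<bar>G n x - lim (\<lambda>n. G n s)\<bar> \<le> \<epsilon>" if "n \<ge> K" "dist x s < \<delta>" for n x
  proof (rule Lim_bounded)
    show "(\<lambda>n'. \<bar>G n x - G n' s\<bar>) \<longlonglongrightarrow> \<bar>G n x - lim (\<lambda>n. G n s)\<bar>"
      by (intro tendsto_rabs tendsto_diff tendsto_const lim)
    show "\<forall>n'\<ge>K. \<bar>G n x - G n' s\<bar> \<le> \<epsilon>"
      using that \<delta> by (intro allI impI K) auto
  qed
  then show "\<exists>\<delta>>0. \<exists>K. \<forall>n\<ge>K. \<forall>x. dist x s < \<delta> \<longrightarrow> \<bar>G n x - lim (\<lambda>n. G n s)\<bar> \<le> \<epsilon>"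
    using \<delta> by blast
qed

text \<open>The weights change by at most \<open>1/m\<close> each, so the sum of the \<open>m\<close> errors is bounded by the largest
  increment of \<open>f\<close> over a grid interval.\<close>

lemma dist_nonzero_weight_discrete_integral:
  assumes f: "continuous_on {0..1} f"
  shows "(\<lambda>m. dist
      (to_D01 (sum_path m (\<lambda>l. nonzero_weight a m l * (f (real (Suc l) / real m) - f (real l / real m)))))
      (to_D01 (discrete_integral a m f))) \<longlonglongrightarrow> 0"
proof (rule metric_LIMSEQ_I)
  fix r :: real assume r: "r > 0"
  have "uniformly_continuous_on {0..1} f"
    using f by (intro compact_uniformly_continuous) auto
  then obtain d where d: "d > 0"
      "\<And>s t. s \<in> {0..1} \<Longrightarrow> t \<in> {0..1} \<Longrightarrow> dist t s < d \<Longrightarrow> dist (f t) (f s) < r / 2"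
    unfolding uniformly_continuous_on_def using half_gt_zero[OF r] by metis
  obtain n :: nat where n: "1 / d < real n" using reals_Archimedean2 by blast
  let ?D = "\<lambda>m l. f (real (Suc l) / real m) - f (real l / real m)"
  have "dist (to_D01 (sum_path m (\<lambda>l. nonzero_weight a m l * ?D m l))) (to_D01 (discrete_integral a m f)) < r"
    if "m \<ge> Suc n" for m
  proof -
    have m: "real m > 0" "1 / d < real m" using that n by auto
    then have md: "1 / real m < d" using d(1) by (simp add: field_simps)
    have "dist (to_D01 (sum_path m (\<lambda>l. nonzero_weight a m l * ?D m l))) (to_D01 (discrete_integral a m f))
        \<le> (\<Sum>l<m. \<bar>nonzero_weight a m l * ?D m l - a (real (Suc l) / real m) * ?D m l\<bar>)"
      unfolding discrete_integral_def by (rule dist_sum_path_le_sum)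
    also have "\<dots> \<le> (\<Sum>l<m. 1 / real m * (r / 2))"
    proof (rule sum_mono)
      fix l assume l: "l \<in> {..<m}"
      have "dist (real (Suc l) / real m) (real l / real m) = 1 / real m"
        by (simp add: dist_real_def diff_divide_distrib[symmetric])
      then have "dist (f (real (Suc l) / real m)) (f (real l / real m)) < r / 2"
        using l m md by (intro d(2)) auto
      then have "\<bar>?D m l\<bar> \<le> r / 2" by (simp add: dist_real_def)
      then show "\<bar>nonzero_weight a m l * ?D m l - a (real (Suc l) / real m) * ?D m l\<bar> \<le> 1 / real m * (r / 2)"
        unfolding left_diff_distrib[symmetric] abs_mult
        using nonzero_weight_near by (intro mult_mono) auto
    qed
    also have "\<dots> = r / 2" using m by simp
    finally show ?thesis using r by linarith
  qed
  then show "\<exists>n. \<forall>m\<ge>n. dist (dist (to_D01 (sum_path m (\<lambda>l. nonzero_weight a m l * ?D m l)))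
      (to_D01 (discrete_integral a m f))) 0 < r" by auto
qed

text \<open>Both sides are limits, as \<open>m \<rightarrow> \<infinity>\<close>, of the expectations of \<open>F\<close> at step paths on the grid of mesh \<open>1/m\<close>:
  with the jumps \<open>\<xi>\<close>, the weighted increments of \<open>\<sigma> W\<^sub>0\<close>, on the left and with the jumps \<open>\<zeta>\<close>, the increments of \<open>W\<close> along
  the discrete clock, on the right. For each \<open>m\<close> the two expectations agree.\<close>

lemma expectation_limit_time_changed:
  fixes F :: "skorokhod01 \<Rightarrow> real"
  assumes av: "increments_dominated a v" and "\<sigma> \<noteq> 0"
    and W0: "wiener_process_on {0..1} M\<^sub>0 W\<^sub>0" and W: "wiener_process_on {0..} M\<^sub>1 W"
    and F: "\<And>x y. \<bar>F x - F y\<bar> \<le> L * dist x y" and F_bound: "\<And>x. \<bar>F x\<bar> \<le> B"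
    and Y_meas [measurable]: "path01 (\<lambda>t \<omega>. \<sigma> * W\<^sub>0 t \<omega>) \<in> borel_measurable M\<^sub>0"
  defines "b \<equiv> \<lambda>t. \<sigma>\<^sup>2 * integral {0..t} (\<lambda>s. (a s)\<^sup>2)"
    and "G \<equiv> \<lambda>n x. F (to_D01 (discrete_integral a n (apply_skorokhod01 x)))"
  shows "(\<integral>\<omega>. lim (\<lambda>n. G n (path01 (\<lambda>t \<omega>. \<sigma> * W\<^sub>0 t \<omega>) \<omega>)) \<partial>M\<^sub>0) = (\<integral>\<omega>. F (path01 (\<lambda>t \<omega>. W (b t) \<omega>) \<omega>) \<partial>M\<^sub>1)"
    and "random_element_D01 M\<^sub>1 (\<lambda>t \<omega>. W (b t) \<omega>)"
proof -
  interpret M0: prob_space M\<^sub>0 using W0 by (simp add: wiener_process_on_def)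
  interpret M1: prob_space M\<^sub>1 using W by (simp add: wiener_process_on_def)
  have W0_meas [measurable]: "W\<^sub>0 t \<in> borel_measurable M\<^sub>0" if "t \<in> {0..1}" for t
    using W0 that unfolding wiener_process_on_def by blast
  have W_meas [measurable]: "W t \<in> borel_measurable M\<^sub>1" if "0 \<le> t" for t
    using W that unfolding wiener_process_on_def by simp
  have W0_cont: "continuous_on {0..1} (\<lambda>t. \<sigma> * W\<^sub>0 t \<omega>)" if "\<omega> \<in> space M\<^sub>0" for \<omega>
    using W0 that unfolding wiener_process_on_def by (intro continuous_on_mult_left) blast
  have W_cont: "continuous_on {0..} (\<lambda>t. W t \<omega>)" if "\<omega> \<in> space M\<^sub>1" for \<omega>
    using W that unfolding wiener_process_on_def by blast
  have F_cont: "continuous_on UNIV F" using F by (rule lipschitz_imp_continuous)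
  have F_meas [measurable]: "F \<in> borel_measurable borel"
    by (rule borel_measurable_continuous_onI[OF F_cont])

  define A where "A = \<bar>a 0\<bar> + (v 1 - v 0)"
  have A: "\<bar>a s\<bar> \<le> A" if "s \<in> {0..1}" for s
    using increments_dominated_bound[OF av that] by (simp add: A_def)
  have "(\<lambda>s. (a s)\<^sup>2) integrable_on {0..1}"
    by (rule increments_dominated_integrable[OF increments_dominated_square[OF av A]])
  then have b_cont: "continuous_on {0..1} b"
    unfolding b_def by (intro continuous_on_mult_left indefinite_integral_continuous_1)
  \<comment> \<open>For \<open>t > 1\<close> the integral may fail to exist and is then zero.\<close>
  have b_nonneg: "0 \<le> b t" for t
  proof (cases "(\<lambda>s. (a s)\<^sup>2) integrable_on {0..t}")
    case True
    then show ?thesis unfolding b_def by (intro mult_nonneg_nonneg integral_nonneg) auto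
  qed (simp add: b_def not_integrable_integral)
  have Wb_cont: "continuous_on {0..1} (\<lambda>t. W (b t) \<omega>)" if "\<omega> \<in> space M\<^sub>1" for \<omega>
    by (rule continuous_on_compose2[OF W_cont[OF that] b_cont]) (use b_nonneg in auto)
  show re: "random_element_D01 M\<^sub>1 (\<lambda>t \<omega>. W (b t) \<omega>)"
    by (rule random_element_continuous_process[OF M1.prob_space_axioms]) (use b_nonneg Wb_cont in auto)

  let ?Y = "path01 (\<lambda>t \<omega>. \<sigma> * W\<^sub>0 t \<omega>)"
  define \<xi> where "\<xi> m \<omega> j = \<sigma> * nonzero_weight a m j * (W\<^sub>0 (real (Suc j) / real m) \<omega> - W\<^sub>0 (real j / real m) \<omega>)" for m \<omega> j
  define \<zeta> where "\<zeta> m \<omega> j = W (discrete_clock a \<sigma> m (Suc j)) \<omega> - W (discrete_clock a \<sigma> m j) \<omega>" for m \<omega> j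
  have Y_apply: "apply_skorokhod01 (?Y \<omega>) t = \<sigma> * W\<^sub>0 t \<omega>" if "\<omega> \<in> space M\<^sub>0" "t \<in> {0..1}" for \<omega> t
    using that W0_cont by (simp add: path01_eq apply_to_D01 cadlag_continuous_on)
  have Y_cont: "continuous_on {0..1} (apply_skorokhod01 (?Y \<omega>))" if "\<omega> \<in> space M\<^sub>0" for \<omega>
    by (rule apply_path01_continuous) (rule W0_cont[OF that])

  have "(\<lambda>m. F (to_D01 (sum_path m (\<xi> m \<omega>)))) \<longlonglongrightarrow> lim (\<lambda>n. G n (?Y \<omega>))" if \<omega>: "\<omega> \<in> space M\<^sub>0" for \<omega>
  proof -
    have "(\<lambda>n. G n (?Y \<omega>)) \<longlonglongrightarrow> lim (\<lambda>n. G n (?Y \<omega>))"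
      unfolding G_def by (rule lipschitz_functional_converges(1)[OF av F Y_cont[OF \<omega>] zero_less_one])
    moreover have "(\<lambda>m. F (to_D01 (sum_path m (\<xi> m \<omega>))) - G m (?Y \<omega>)) \<longlonglongrightarrow> 0"
    proof -
      let ?f = "apply_skorokhod01 (?Y \<omega>)"
      let ?P = "\<lambda>m. sum_path m (\<lambda>l. nonzero_weight a m l * (?f (real (Suc l) / real m) - ?f (real l / real m)))"
      have P: "to_D01 (sum_path m (\<xi> m \<omega>)) = to_D01 (?P m)" for m
      proof (rule to_D01_cong)
        fix t :: real assume t: "t \<in> {0..1}"
        have "\<xi> m \<omega> l = nonzero_weight a m l * (?f (real (Suc l) / real m) - ?f (real l / real m))"
          if "l < nat \<lfloor>real m * t\<rfloor>" for l
        proof -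
          have "l < m" using that floor_le_grid[OF t, of m] by simp
          then have "real (Suc l) / real m \<in> {0..1}" "real l / real m \<in> {0..1}" by auto
          then show ?thesis unfolding \<xi>_def by (simp only: Y_apply[OF \<omega>]) (simp add: algebra_simps)
        qed
        then show "sum_path m (\<xi> m \<omega>) t = ?P m t" unfolding sum_path_def by (intro sum.cong) auto
      qed
      have lim: "(\<lambda>m. L * dist (to_D01 (?P m)) (to_D01 (discrete_integral a m ?f))) \<longlonglongrightarrow> 0"
        using tendsto_mult_right_zero[OF dist_nonzero_weight_discrete_integral[OF Y_cont[OF \<omega>], of a]] .
      show ?thesis
        by (rule Lim_null_comparison[OF always_eventually lim]) (simp add: P G_def F)
    qed
    ultimately show ?thesis using tendsto_add by fastforce
  qed
  moreover have \<xi>_meas [measurable]: "(\<lambda>\<omega>. to_D01 (sum_path m (\<xi> m \<omega>))) \<in> borel_measurable M\<^sub>0" for m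
  proof -
    \<comment> \<open>Jumps beyond the grid would use \<open>W\<^sub>0\<close> outside \<open>[0,1]\<close>, where nothing is known about it.\<close>
    have "(\<lambda>\<omega>. to_D01 (sum_path m (\<lambda>j. if j < m then \<xi> m \<omega> j else 0))) \<in> borel_measurable M\<^sub>0"
    proof (rule measurable_sum_path)
      fix l
      show "(\<lambda>\<omega>. if l < m then \<xi> m \<omega> l else 0) \<in> borel_measurable M\<^sub>0"
      proof (cases "l < m")
        case True
        then have "real (Suc l) / real m \<in> {0..1}" "real l / real m \<in> {0..1}" by auto
        from this[THEN W0_meas] show ?thesis unfolding \<xi>_def by measurable
      qed simp
    qed
    moreover have "to_D01 (sum_path m (\<lambda>j. if j < m then \<xi> m \<omega> j else 0)) = to_D01 (sum_path m (\<xi> m \<omega>))" for \<omega>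
    proof (rule to_D01_cong)
      fix t :: real assume "t \<in> {0..1}"
      from floor_le_grid[OF this, of m]
      show "sum_path m (\<lambda>j. if j < m then \<xi> m \<omega> j else 0) t = sum_path m (\<xi> m \<omega>) t"
        unfolding sum_path_def by (intro sum.cong) auto
    qed
    ultimately show ?thesis by simp
  qed
  ultimately have lim0: "(\<lambda>m. \<integral>\<omega>. F (to_D01 (sum_path m (\<xi> m \<omega>))) \<partial>M\<^sub>0) \<longlonglongrightarrow> (\<integral>\<omega>. lim (\<lambda>n. G n (?Y \<omega>)) \<partial>M\<^sub>0)"
  proof (intro integral_dominated_convergence[where w = "\<lambda>_. B"])
    show "(\<lambda>\<omega>. lim (\<lambda>n. G n (?Y \<omega>))) \<in> borel_measurable M\<^sub>0"
      if lim: "\<And>\<omega>. \<omega> \<in> space M\<^sub>0 \<Longrightarrow> (\<lambda>m. F (to_D01 (sum_path m (\<xi> m \<omega>)))) \<longlonglongrightarrow> lim (\<lambda>n. G n (?Y \<omega>))"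
      by (rule borel_measurable_LIMSEQ_metric[OF _ lim]) measurable
  qed (use F_bound in auto)

  obtain C where C: "\<And>m t. m > 0 \<Longrightarrow> t \<in> {0..1} \<Longrightarrow> \<bar>discrete_clock a \<sigma> m (nat \<lfloor>real m * t\<rfloor>) - b t\<bar> \<le> C / real m"
    unfolding b_def using discrete_clock_near[OF av, where \<sigma> = \<sigma>] by blast
  have "bounded (b ` {0..1})"
    by (intro compact_imp_bounded compact_continuous_image b_cont) auto
  then obtain T where T: "\<And>t. t \<in> {0..1} \<Longrightarrow> b t \<le> T"
    unfolding bounded_iff by (metis abs_le_D1 image_eqI real_norm_def)
  have clock_le: "discrete_clock a \<sigma> m (nat \<lfloor>real m * t\<rfloor>) \<in> {0..T + \<bar>C\<bar>}" if "m > 0" "t \<in> {0..1}" for m t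
  proof -
    have "C / real m \<le> \<bar>C\<bar> / 1" using that by (intro frac_le) auto
    then show ?thesis using C[OF that] T[OF that(2)] discrete_clock_nonneg[of a \<sigma> m] by auto
  qed
  have lim1: "(\<lambda>m. \<integral>\<omega>. F (to_D01 (sum_path m (\<zeta> m \<omega>))) \<partial>M\<^sub>1) \<longlonglongrightarrow> (\<integral>\<omega>. F (path01 (\<lambda>t \<omega>. W (b t) \<omega>) \<omega>) \<partial>M\<^sub>1)"
  proof (rule integral_dominated_convergence[where w = "\<lambda>_. B"])
    have "AE \<omega> in M\<^sub>1. W 0 \<omega> = 0" using W by (simp add: wiener_process_on_def)
    then show "AE \<omega> in M\<^sub>1. (\<lambda>m. F (to_D01 (sum_path m (\<zeta> m \<omega>)))) \<longlonglongrightarrow> F (path01 (\<lambda>t \<omega>. W (b t) \<omega>) \<omega>)"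
    proof (rule AE_mp[OF _ AE_I2], intro impI)
      fix \<omega> assume \<omega>: "\<omega> \<in> space M\<^sub>1" and W_0: "W 0 \<omega> = 0"
      have "(\<Sum>l<k. \<zeta> m \<omega> l) = W (discrete_clock a \<sigma> m k) \<omega>" for m k
        unfolding \<zeta>_def using sum_lessThan_telescope[of "\<lambda>l. W (discrete_clock a \<sigma> m l) \<omega>" k] W_0
        by (simp add: discrete_clock_def)
      then have "sum_path m (\<zeta> m \<omega>) = step_path m (\<lambda>k. W (discrete_clock a \<sigma> m k) \<omega>)" for m
        by (simp add: sum_path_eq_step_path)
      moreover have "(\<lambda>m. to_D01 (step_path m (\<lambda>k. W (discrete_clock a \<sigma> m k) \<omega>))) \<longlonglongrightarrow> to_D01 (\<lambda>t. W (b t) \<omega>)"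
      proof (rule tendsto_step_path_time_change[where g = "\<lambda>s. W s \<omega>" and B = "T + \<bar>C\<bar>", OF _ b_cont _ clock_le C])
        show "continuous_on {0..T + \<bar>C\<bar>} (\<lambda>s. W s \<omega>)"
          by (rule continuous_on_subset[OF W_cont[OF \<omega>]]) auto
        show "b t \<in> {0..T + \<bar>C\<bar>}" if "t \<in> {0..1}" for t using T[OF that] b_nonneg[of t] by auto
      qed
      ultimately show "(\<lambda>m. F (to_D01 (sum_path m (\<zeta> m \<omega>)))) \<longlonglongrightarrow> F (path01 (\<lambda>t \<omega>. W (b t) \<omega>) \<omega>)"
        unfolding path01_eq by (intro continuous_on_tendsto_compose[OF F_cont]) auto
    qed
    show "(\<lambda>\<omega>. F (path01 (\<lambda>t \<omega>. W (b t) \<omega>) \<omega>)) \<in> borel_measurable M\<^sub>1"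
      using re unfolding random_element_D01_def by (intro measurable_compose[OF _ F_meas]) blast
    show "(\<lambda>\<omega>. F (to_D01 (sum_path m (\<zeta> m \<omega>)))) \<in> borel_measurable M\<^sub>1" for m
      unfolding \<zeta>_def using discrete_clock_nonneg
      by (intro measurable_compose[OF _ F_meas] measurable_sum_path borel_measurable_diff W_meas) auto
  qed (use F_bound in auto)

  have "(\<integral>\<omega>. F (to_D01 (sum_path m (\<xi> m \<omega>))) \<partial>M\<^sub>0) = (\<integral>\<omega>. F (to_D01 (sum_path m (\<zeta> m \<omega>))) \<partial>M\<^sub>1)" if m: "m > 0" for m
    unfolding \<xi>_def \<zeta>_def
  proof (rule expectation_weighted_increments_eq_time_changed[OF W0 W \<open>\<sigma> \<noteq> 0\<close> m])
    show "(\<lambda>x. F (to_D01 (sum_path m x))) \<in> borel_measurable borel"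
      by (intro measurable_compose[OF _ F_meas] measurable_sum_path
          borel_measurable_continuous_onI continuous_on_product_coordinates)
    fix x y :: "nat \<Rightarrow> real" assume xy: "\<And>j. j < m \<Longrightarrow> x j = y j"
    have "to_D01 (sum_path m x) = to_D01 (sum_path m y)"
    proof (rule to_D01_cong)
      fix t :: real assume "t \<in> {0..1}"
      from floor_le_grid[OF this, of m]
      show "sum_path m x t = sum_path m y t" unfolding sum_path_def by (intro sum.cong xy) auto
    qed
    then show "F (to_D01 (sum_path m x)) = F (to_D01 (sum_path m y))" by simp
  qed
  then have "\<forall>\<^sub>F m in sequentially. (\<integral>\<omega>. F (to_D01 (sum_path m (\<zeta> m \<omega>))) \<partial>M\<^sub>1) = (\<integral>\<omega>. F (to_D01 (sum_path m (\<xi> m \<omega>))) \<partial>M\<^sub>0)"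
    by (intro eventually_mono[OF eventually_gt_at_top[of 0]]) simp
  then show "(\<integral>\<omega>. lim (\<lambda>n. G n (?Y \<omega>)) \<partial>M\<^sub>0) = (\<integral>\<omega>. F (path01 (\<lambda>t \<omega>. W (b t) \<omega>) \<omega>) \<partial>M\<^sub>1)"
    by (rule LIMSEQ_unique[OF lim0 Lim_transform_eventually[OF lim1]])
qed

theorem theorem2p1:
  fixes a :: "real \<Rightarrow> real" and \<sigma> :: real
    and M :: "'a measure" and e :: "nat \<Rightarrow> 'a \<Rightarrow> real"
    and M\<^sub>0 :: "'b measure" and W\<^sub>0 :: "real \<Rightarrow> 'b \<Rightarrow> real"
    and M\<^sub>1 :: "'c measure" and W :: "real \<Rightarrow> 'c \<Rightarrow> real"
  defines "u \<equiv> \<lambda>(N::nat) (i::nat) \<omega>. a (real i / real N) * e i \<omega>"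
    and "b \<equiv> \<lambda>t. \<sigma>\<^sup>2 * integral {0..t} (\<lambda>s. (a s)\<^sup>2)"
  assumes "bounded_variation_on 0 1 a"
    and "prob_space M"
    and "\<And>i. i \<ge> 1 \<Longrightarrow> e i \<in> borel_measurable M"
    and "\<And>i. i \<ge> 1 \<Longrightarrow> integrable M (e i)"
    and "\<And>i. i \<ge> 1 \<Longrightarrow> (\<integral>\<omega>. e i \<omega> \<partial>M) = 0"
    and "\<sigma> > 0"
    and "wiener_process_on {0..1} M\<^sub>0 W\<^sub>0"
    and "weakly_converges_D01
           M (\<lambda>N t \<omega>. 1 / sqrt (real N) * (\<Sum>l = 1..nat \<lfloor>real N * t\<rfloor>. e l \<omega>))
           M\<^sub>0 (\<lambda>t \<omega>. \<sigma> * W\<^sub>0 t \<omega>)"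
    and "wiener_process_on {0..} M\<^sub>1 W"
  shows "weakly_converges_D01
           M (\<lambda>N t \<omega>. 1 / sqrt (real N) * (\<Sum>l = 1..nat \<lfloor>real N * t\<rfloor>. u N l \<omega>))
           M\<^sub>1 (\<lambda>t \<omega>. W (b t) \<omega>)"
proof -
  interpret M: prob_space M by fact
  have M1: "prob_space M\<^sub>1" using assms(11) by (simp add: wiener_process_on_def)
  obtain v where av: "increments_dominated a v"
    using bounded_variation_increments_dominated[OF assms(3)] .
  define S where "S N \<omega> = to_D01 (sum_path N (\<lambda>l. e (Suc l) \<omega> / sqrt (real N)))" for N \<omega>
  define Z where "Z N \<omega> = to_D01 (sum_path N (\<lambda>l. a (real (Suc l) / real N) * (e (Suc l) \<omega> / sqrt (real N))))" for N \<omega>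
  let ?Y = "path01 (\<lambda>t \<omega>. \<sigma> * W\<^sub>0 t \<omega>)" and ?V = "path01 (\<lambda>t \<omega>. W (b t) \<omega>)"
  let ?X = "\<lambda>N t \<omega>. 1 / sqrt (real N) * (\<Sum>l = 1..nat \<lfloor>real N * t\<rfloor>. u N l \<omega>)"
  have X_eq: "?X N t \<omega> = sum_path N (\<lambda>l. a (real (Suc l) / real N) * (e (Suc l) \<omega> / sqrt (real N))) t" for N t \<omega>
    unfolding normalized_partial_sum by (simp add: u_def)
  have path_S: "path01 (\<lambda>t \<omega>. 1 / sqrt (real N) * (\<Sum>l = 1..nat \<lfloor>real N * t\<rfloor>. e l \<omega>)) = S N" for N
    by (simp only: fun_eq_iff path01_eq S_def normalized_partial_sum) simp
  have path_Z: "path01 (?X N) = Z N" for N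
    by (simp only: fun_eq_iff path01_eq Z_def X_eq) simp
  have Z_S: "to_D01 (discrete_integral a N (apply_skorokhod01 (S N \<omega>))) = Z N \<omega>" for N \<omega>
    unfolding S_def Z_def by (rule discrete_integral_sum_path)
  have S_meas: "S N \<in> borel_measurable M" and Z_meas: "Z N \<in> borel_measurable M" for N
    unfolding S_def[abs_def] Z_def[abs_def] using assms(5) by (auto intro!: measurable_sum_path)
  have Y: "random_element_D01 M\<^sub>0 (\<lambda>t \<omega>. \<sigma> * W\<^sub>0 t \<omega>)"
    and S_conv: "\<And>F :: skorokhod01 \<Rightarrow> real. continuous_on UNIV F \<Longrightarrow> bounded (range F) \<Longrightarrow>
      (\<lambda>N. \<integral>\<omega>. F (S N \<omega>) \<partial>M) \<longlonglongrightarrow> (\<integral>\<omega>. F (?Y \<omega>) \<partial>M\<^sub>0)"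
    using assms(10) unfolding weakly_converges_D01_def path_S by auto
  then have M0: "prob_space M\<^sub>0" and Y_meas: "?Y \<in> borel_measurable M\<^sub>0"
    unfolding random_element_D01_def by auto
  have Y_cont: "continuous_on {0..1} (apply_skorokhod01 (?Y \<omega>))" if "\<omega> \<in> space M\<^sub>0" for \<omega>
    using assms(9) that unfolding wiener_process_on_def
    by (intro apply_path01_continuous continuous_on_mult_left) blast
  have V: "random_element_D01 M\<^sub>1 (\<lambda>t \<omega>. W (b t) \<omega>)"
    unfolding b_def using assms(8)
    by (intro expectation_limit_time_changed(2)[OF av _ assms(9,11), of \<sigma> "\<lambda>_. 0" 0 0] Y_meas) auto
  then have V_meas: "?V \<in> borel_measurable M\<^sub>1" by (simp add: random_element_D01_def)

  \<comment> \<open>Lipschitz functionals, by applying the continuous mapping theorem to \<open>F\<close> of the discrete integrals.\<close>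
  have lip: "(\<lambda>N. \<integral>\<omega>. F (Z N \<omega>) \<partial>M) \<longlonglongrightarrow> (\<integral>\<omega>. F (?V \<omega>) \<partial>M\<^sub>1)"
    if F: "\<forall>x y. \<bar>F x - F y\<bar> \<le> L * dist x y" and F_bdd: "bounded (range F)" for F :: "skorokhod01 \<Rightarrow> real" and L
  proof -
    obtain B where B: "\<And>x. \<bar>F x\<bar> \<le> B" using F_bdd by (auto simp: bounded_iff)
    let ?G = "\<lambda>n x. F (to_D01 (discrete_integral a n (apply_skorokhod01 x)))"
    have "(\<lambda>N. \<integral>\<omega>. ?G N (S N \<omega>) \<partial>M) \<longlonglongrightarrow> (\<integral>\<omega>. lim (\<lambda>n. ?G n (?Y \<omega>)) \<partial>M\<^sub>0)"
    proof (rule extended_continuous_mapping[OF \<open>prob_space M\<close> M0 S_meas Y_meas, where G = ?G and B = B])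
      show "(\<lambda>\<omega>. ?G n (S n \<omega>)) \<in> borel_measurable M" for n
        unfolding Z_S by (rule measurable_compose[OF Z_meas borel_measurable_continuous_onI[OF lipschitz_imp_continuous[OF F[rule_format]]]])
      show "\<exists>\<delta>>0. \<exists>K. \<forall>n\<ge>K. \<forall>s. dist s (?Y \<omega>) < \<delta> \<longrightarrow> \<bar>?G n s - lim (\<lambda>n. ?G n (?Y \<omega>))\<bar> \<le> \<epsilon>"
        if "\<omega> \<in> space M\<^sub>0" "\<epsilon> > 0" for \<omega> \<epsilon>
        by (rule lipschitz_functional_converges(2)[OF av _ Y_cont[OF that(1)] that(2)]) (use F in blast)
      show "(\<lambda>n. \<integral>\<omega>. H (S n \<omega>) \<partial>M) \<longlonglongrightarrow> (\<integral>\<omega>. H (?Y \<omega>) \<partial>M\<^sub>0)"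
        if "\<forall>s t. \<bar>H s - H t\<bar> \<le> L' * dist s t" "bounded (range H)" for H L'
        by (intro S_conv lipschitz_imp_continuous[OF that(1)[rule_format]] that(2))
    qed (use B in auto)
    moreover have "(\<integral>\<omega>. lim (\<lambda>n. ?G n (?Y \<omega>)) \<partial>M\<^sub>0) = (\<integral>\<omega>. F (?V \<omega>) \<partial>M\<^sub>1)"
      unfolding b_def using assms(8) F B
      by (intro expectation_limit_time_changed(1)[OF av _ assms(9,11), of \<sigma> F L B] Y_meas) auto
    ultimately show ?thesis by (simp only: Z_S)
  qed

  \<comment> \<open>Continuous functionals, by applying it once more to the constant sequence \<open>F\<close>.\<close>
  have "(\<lambda>N. \<integral>\<omega>. F (Z N \<omega>) \<partial>M) \<longlonglongrightarrow> (\<integral>\<omega>. F (?V \<omega>) \<partial>M\<^sub>1)"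
    if F: "continuous_on UNIV F" and F_bdd: "bounded (range F)" for F :: "skorokhod01 \<Rightarrow> real"
  proof -
    obtain B where B: "\<And>x. \<bar>F x\<bar> \<le> B" using F_bdd by (auto simp: bounded_iff)
    show ?thesis
    proof (rule extended_continuous_mapping[OF \<open>prob_space M\<close> M1 Z_meas V_meas B _ lip])
      show "(\<lambda>\<omega>. F (Z n \<omega>)) \<in> borel_measurable M" for n
        by (rule measurable_compose[OF Z_meas borel_measurable_continuous_onI[OF F]])
      show "\<exists>\<delta>>0. \<exists>K. \<forall>n\<ge>K. \<forall>s. dist s (?V \<omega>) < \<delta> \<longrightarrow> \<bar>F s - F (?V \<omega>)\<bar> \<le> \<epsilon>" if "\<epsilon> > 0" for \<omega> \<epsilon>
        using F that unfolding continuous_on_iff dist_real_def by (metis UNIV_I less_imp_le)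
    qed
  qed
  moreover have "random_element_D01 M (?X N)" for N
    unfolding random_element_D01_def path_Z
    unfolding X_eq using \<open>prob_space M\<close> Z_meas[of N] cadlag_sum_path by blast
  ultimately show ?thesis
    using V unfolding weakly_converges_D01_def path_Z by blast
qed

end
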